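(* Let $k\geq 2$. For every non-constant element $\mathcal{Z}\in U(\hat{\mathfrak g}_k^-)$ (i.e. $\mathcal{Z}\notin\mathbb{C}\cdot 1$) there exists $p_o>0$ such that $[\mathfrak g\otimes t_{k-1}^{r},\mathcal{Z}]\neq 0$ for all $r\geq p_o$; that is, for every integer $r\ge p_o$ there is some $x\in\mathfrak g$ such that the commutator $[x\otimes t_{k-1}^r,\mathcal{Z}]$, computed in $U(\hat{\mathfrak g}_k)$, is nonzero.
   Context: $\mathfrak g$ is a simple Lie algebra over $\mathbb{C}$ with Cartan subalgebra $\mathfrak t$, and $\langle\,,\,\rangle$ is the invariant symmetric bilinear form on $\mathfrak g$ normalized so that the induced form on $\mathfrak t^*$ satisfies $\langle\theta,\theta\rangle=2$ for the highest root $\theta$. Let $A_k=\mathbb{C}[t_1^{\pm1},\dots,t_k^{\pm1}]$ and, for ${\bf n}=(n_1,\dots,n_k)\in\mathbb{Z}^k$, ${\bf t}^{\bf n}=t_1^{n_1}\cdots t_k^{n_k}$. Define $$\hat{\mathfrak g}_k=(\mathfrak g\otimes A_k)\oplus\bigoplus_{i=1}^k\mathbb{C}c_i\oplus\bigoplus_{i=1}^k\mathbb{C}d_i$$ with the $c_i$ central and $$[x\otimes{\bf t}^{\bf n},y\otimes{\bf t}^{\bf m}]=[x,y]\otimes{\bf t}^{{\bf n}+{\bf m}}+\delta_{{\bf n}+{\bf m},0}\langle x,y\rangle(n_1c_1+\cdots+n_kc_k),$$ $$[d_i,x\otimes{\bf t}^{\bf n}]=n_i\,x\otimes{\bf t}^{\bf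 n},\qquad [d_i,d_j]=[d_i,c_j]=0.$$ Let $A_k^-=t_k^{-1}\mathbb{C}[t_1^{\pm1},\dots,t_{k-1}^{\pm1},t_k^{-1}]$ and $\hat{\mathfrak g}_k^-=\mathfrak g\otimes A_k^-\subset\hat{\mathfrak g}_k$ (a Lie subalgebra). $U(\cdot)$ denotes the universal enveloping algebra. *)

theory Defs
  imports Complex_Main "HOL-Library.Poly_Mapping" "HOL-Library.Product_Plus" "HOL-Algebra.QuotRing"
begin

section \<open>Lie algebras over the complex numbers\<close>

locale lie_algebra = vector_space scale
  for scale :: "complex \<Rightarrow> 'a::ab_group_add \<Rightarrow> 'a" +
  fixes bracket :: "'a \<Rightarrow> 'a \<Rightarrow> 'a"
  assumes bracket_linear_right: "Vector_Spaces.linear scale scale (\<lambda>y. bracket x y)"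
    and bracket_linear_left: "Vector_Spaces.linear scale scale (\<lambda>x. bracket x y)"
    and bracket_self: "bracket x x = 0"
    and jacobi: "bracket x (bracket y z) + bracket y (bracket z x) + bracket z (bracket x y) = 0"
begin

definition lie_subalgebra :: "'a set \<Rightarrow> bool" where
  "lie_subalgebra S \<longleftrightarrow> subspace S \<and> (\<forall>x\<in>S. \<forall>y\<in>S. bracket x y \<in> S)"

definition lie_ideal :: "'a set \<Rightarrow> bool" where
  "lie_ideal I \<longleftrightarrow> subspace I \<and> (\<forall>x. \<forall>y\<in>I. bracket x y \<in> I)"

primrec lower_central_series :: "'a set \<Rightarrow> nat \<Rightarrow> 'a set" where
  "lower_central_series S 0 = S"
| "lower_central_series S (Suc n) = span {bracket x y |x y. x \<in> S \<and> y \<in> lower_central_series S n}"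

definition lie_nilpotent :: "'a set \<Rightarrow> bool" where
  "lie_nilpotent S \<longleftrightarrow> (\<exists>n. lower_central_series S n = {0})"

definition lie_normalizer :: "'a set \<Rightarrow> 'a set" where
  "lie_normalizer S = {x. \<forall>y\<in>S. bracket x y \<in> S}"

definition cartan_subalgebra :: "'a set \<Rightarrow> bool" where
  "cartan_subalgebra H \<longleftrightarrow> lie_subalgebra H \<and> lie_nilpotent H \<and> lie_normalizer H = H"

text \<open>Linear functionals on a subspace are extended by zero outside of it, so that equality of
  functionals is equality of functions.\<close>

definition dual_space :: "'a set \<Rightarrow> ('a \<Rightarrow> complex) set" where
  "dual_space H = {\<alpha>. (\<forall>x\<in>H. \<forall>y\<in>H. \<alpha> (x + y) = \<alpha> x + \<alpha> y) \<and>
     (\<forall>c. \<forall>x\<in>H. \<alpha> (scale c x) = c * \<alpha> x) \<and> (\<forall>x. x \<notin> H \<longrightarrow> \<alpha> x = 0)}"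

definition roots :: "'a set \<Rightarrow> ('a \<Rightarrow> complex) set" where
  "roots H = {\<alpha> \<in> dual_space H. \<alpha> \<noteq> (\<lambda>_. 0) \<and>
     (\<exists>x. x \<noteq> 0 \<and> (\<forall>h\<in>H. bracket h x = scale (\<alpha> h) x))}"

definition simple_roots :: "'a set \<Rightarrow> ('a \<Rightarrow> complex) set \<Rightarrow> bool" where
  "simple_roots H \<Delta> \<longleftrightarrow> finite \<Delta> \<and> \<Delta> \<subseteq> roots H \<and>
     (\<forall>c :: ('a \<Rightarrow> complex) \<Rightarrow> complex.
        (\<forall>h. (\<Sum>\<alpha>\<in>\<Delta>. c \<alpha> * \<alpha> h) = 0) \<longrightarrow> (\<forall>\<alpha>\<in>\<Delta>. c \<alpha> = 0)) \<and>
     (\<forall>\<beta>\<in>roots H. \<exists>m :: ('a \<Rightarrow> complex) \<Rightarrow> nat.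
        (\<forall>h. \<beta> h = (\<Sum>\<alpha>\<in>\<Delta>. of_nat (m \<alpha>) * \<alpha> h)) \<or>
        (\<forall>h. \<beta> h = - (\<Sum>\<alpha>\<in>\<Delta>. of_nat (m \<alpha>) * \<alpha> h)))"

definition highest_root :: "'a set \<Rightarrow> ('a \<Rightarrow> complex) set \<Rightarrow> ('a \<Rightarrow> complex) \<Rightarrow> bool" where
  "highest_root H \<Delta> \<theta> \<longleftrightarrow> \<theta> \<in> roots H \<and>
     (\<forall>\<beta>\<in>roots H. \<exists>m :: ('a \<Rightarrow> complex) \<Rightarrow> nat.
        \<forall>h. \<theta> h - \<beta> h = (\<Sum>\<alpha>\<in>\<Delta>. of_nat (m \<alpha>) * \<alpha> h))"

definition invariant_form :: "('a \<Rightarrow> 'a \<Rightarrow> complex) \<Rightarrow> bool" where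
  "invariant_form B \<longleftrightarrow>
     (\<forall>x. Vector_Spaces.linear scale (*) (\<lambda>y. B x y)) \<and>
     (\<forall>x y. B x y = B y x) \<and>
     (\<forall>x y z. B (bracket x y) z = B x (bracket y z))"

end

locale simple_lie_algebra = lie_algebra +
  assumes finite_dimensional: "\<exists>S. finite S \<and> span S = UNIV"
    and non_abelian: "\<exists>x y. bracket x y \<noteq> 0"
    and ideal_trivial: "lie_ideal I \<Longrightarrow> I = {0} \<or> I = UNIV"

text \<open>A form \<open>B\<close> that is nondegenerate on \<open>H\<close> identifies the dual of \<open>H\<close> with \<open>H\<close>; the induced form
  on the dual is transported along this identification.\<close>

definition form_representative :: "('a \<Rightarrow> 'a \<Rightarrow> complex) \<Rightarrow> 'a set \<Rightarrow> ('a \<Rightarrow> complex) \<Rightarrow> 'a" where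
  "form_representative B H \<alpha> = (THE x. x \<in> H \<and> (\<forall>h\<in>H. B x h = \<alpha> h))"

definition induced_form ::
  "('a \<Rightarrow> 'a \<Rightarrow> complex) \<Rightarrow> 'a set \<Rightarrow> ('a \<Rightarrow> complex) \<Rightarrow> ('a \<Rightarrow> complex) \<Rightarrow> complex" where
  "induced_form B H \<alpha> \<beta> = B (form_representative B H \<alpha>) (form_representative B H \<beta>)"


section \<open>Universal enveloping algebras\<close>

text \<open>The free associative unital algebra on a set \<open>L\<close> of letters: finitely supported functions on
  words over \<open>L\<close>, multiplied by concatenation of words.\<close>

definition free_algebra :: "'a set \<Rightarrow> ('a list \<Rightarrow> complex) ring" where
  "free_algebra L =
    \<lparr>carrier = {f. finite {w. f w \<noteq> 0} \<and> {w. f w \<noteq> 0} \<subseteq> lists L},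
     mult = (\<lambda>f g w. \<Sum>i\<le>length w. f (take i w) * g (drop i w)),
     one = (\<lambda>w. if w = [] then 1 else 0),
     zero = (\<lambda>_. 0),
     add = (\<lambda>f g w. f w + g w)\<rparr>"

definition free_scalar :: "complex \<Rightarrow> 'a list \<Rightarrow> complex" where
  "free_scalar c = (\<lambda>w. if w = [] then c else 0)"

definition free_letter :: "'a \<Rightarrow> 'a list \<Rightarrow> complex" where
  "free_letter x = (\<lambda>w. if w = [x] then 1 else 0)"

definition commutator :: "('b, 'm) ring_scheme \<Rightarrow> 'b \<Rightarrow> 'b \<Rightarrow> 'b" where
  "commutator R a b = (a \<otimes>\<^bsub>R\<^esub> b) \<ominus>\<^bsub>R\<^esub> (b \<otimes>\<^bsub>R\<^esub> a)"

text \<open>In the following, \<open>L\<close> is a Lie subalgebra of an ambient Lie algebra with the given operations.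
  The first two families of relations turn the free algebra on the set \<open>L\<close> into the tensor algebra
  of the vector space \<open>L\<close>; the third one is the usual relation \<open>xy - yx = [x,y]\<close>.\<close>

definition uea_relations ::
  "(complex \<Rightarrow> 'a::ab_group_add \<Rightarrow> 'a) \<Rightarrow> ('a \<Rightarrow> 'a \<Rightarrow> 'a) \<Rightarrow> 'a set \<Rightarrow> ('a list \<Rightarrow> complex) set" where
  "uea_relations scale bracket L =
     {free_letter (x + y) \<ominus>\<^bsub>free_algebra L\<^esub> (free_letter x \<oplus>\<^bsub>free_algebra L\<^esub> free_letter y)
        |x y. x \<in> L \<and> y \<in> L} \<union>
     {free_letter (scale c x) \<ominus>\<^bsub>free_algebra L\<^esub> (free_scalar c \<otimes>\<^bsub>free_algebra L\<^esub> free_letter x)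
        |c x. x \<in> L} \<union>
     {commutator (free_algebra L) (free_letter x) (free_letter y)
        \<ominus>\<^bsub>free_algebra L\<^esub> free_letter (bracket x y)
        |x y. x \<in> L \<and> y \<in> L}"

definition uea_ideal ::
  "(complex \<Rightarrow> 'a::ab_group_add \<Rightarrow> 'a) \<Rightarrow> ('a \<Rightarrow> 'a \<Rightarrow> 'a) \<Rightarrow> 'a set \<Rightarrow> ('a list \<Rightarrow> complex) set" where
  "uea_ideal scale bracket L = Idl\<^bsub>free_algebra L\<^esub> (uea_relations scale bracket L)"

definition uea ::
  "(complex \<Rightarrow> 'a::ab_group_add \<Rightarrow> 'a) \<Rightarrow> ('a \<Rightarrow> 'a \<Rightarrow> 'a) \<Rightarrow> 'a set \<Rightarrow> ('a list \<Rightarrow> complex) set ring" where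
  "uea scale bracket L = free_algebra L Quot uea_ideal scale bracket L"

definition uea_of ::
  "(complex \<Rightarrow> 'a::ab_group_add \<Rightarrow> 'a) \<Rightarrow> ('a \<Rightarrow> 'a \<Rightarrow> 'a) \<Rightarrow> 'a set \<Rightarrow> 'a \<Rightarrow> ('a list \<Rightarrow> complex) set" where
  "uea_of scale bracket L x = uea_ideal scale bracket L +>\<^bsub>free_algebra L\<^esub> free_letter x"

definition uea_scalar ::
  "(complex \<Rightarrow> 'a::ab_group_add \<Rightarrow> 'a) \<Rightarrow> ('a \<Rightarrow> 'a \<Rightarrow> 'a) \<Rightarrow> 'a set \<Rightarrow> complex \<Rightarrow> ('a list \<Rightarrow> complex) set" where
  "uea_scalar scale bracket L c = uea_ideal scale bracket L +>\<^bsub>free_algebra L\<^esub> free_scalar c"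

text \<open>The map \<open>U(M) \<rightarrow> U(L)\<close> induced by an inclusion \<open>M \<subseteq> L\<close> of Lie subalgebras, where \<open>Z\<close> is an
  element of \<open>U(M)\<close>: it sends the coset of \<open>a\<close> modulo the ideal for \<open>M\<close> to the coset of \<open>a\<close> modulo
  the ideal for \<open>L\<close>, which contains the one for \<open>M\<close>.\<close>

definition uea_extend ::
  "(complex \<Rightarrow> 'a::ab_group_add \<Rightarrow> 'a) \<Rightarrow> ('a \<Rightarrow> 'a \<Rightarrow> 'a) \<Rightarrow> 'a set \<Rightarrow>
   ('a list \<Rightarrow> complex) set \<Rightarrow> ('a list \<Rightarrow> complex) set" where
  "uea_extend scale bracket L Z = uea_ideal scale bracket L <+>\<^bsub>free_algebra L\<^esub> Z"


section \<open>Toroidal Lie algebras\<close>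

text \<open>An exponent vector in \<open>\<int>\<^sup>k\<close> is a finitely supported function on \<open>nat\<close> with support in
  \<open>{1..k}\<close>.  An element of \<open>\<gg> \<otimes> A\<^sub>k\<close> is a Laurent polynomial with coefficients in \<open>\<gg>\<close>, that is, a
  finitely supported function from exponent vectors to \<open>\<gg>\<close>.  A triple \<open>(u, a, b)\<close> stands for
  \<open>u + \<Sum>\<^sub>i a\<^sub>i c\<^sub>i + \<Sum>\<^sub>i b\<^sub>i d\<^sub>i\<close>, with \<open>c\<^sub>i\<close> the central elements and \<open>d\<^sub>i\<close> the derivations.  The operations do not refer to \<open>k\<close>, which only enters in the
  choice of the subspace.\<close>

type_synonym expo = "nat \<Rightarrow>\<^sub>0 int"

type_synonym 'g tor = "(expo \<Rightarrow>\<^sub>0 'g) \<times> (nat \<Rightarrow>\<^sub>0 complex) \<times> (nat \<Rightarrow>\<^sub>0 complex)"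

definition tor_monom :: "'g \<Rightarrow> expo \<Rightarrow> 'g::ab_group_add tor" where
  "tor_monom x n = (Poly_Mapping.single n x, 0, 0)"

fun tor_scale :: "(complex \<Rightarrow> 'g \<Rightarrow> 'g) \<Rightarrow> complex \<Rightarrow> 'g tor \<Rightarrow> 'g::ab_group_add tor" where
  "tor_scale scale s (u, a, b) =
     (Poly_Mapping.map (scale s) u, Poly_Mapping.map ((*) s) a, Poly_Mapping.map ((*) s) b)"

text \<open>The action of \<open>\<Sum>\<^sub>i b\<^sub>i d\<^sub>i\<close> on \<open>\<gg> \<otimes> A\<^sub>k\<close>.\<close>

definition tor_derivation ::
  "(complex \<Rightarrow> 'g \<Rightarrow> 'g) \<Rightarrow> (nat \<Rightarrow>\<^sub>0 complex) \<Rightarrow> (expo \<Rightarrow>\<^sub>0 'g) \<Rightarrow> (expo \<Rightarrow>\<^sub>0 'g::ab_group_add)" where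
  "tor_derivation scale b u =
     (\<Sum>n\<in>Poly_Mapping.keys u. Poly_Mapping.single n
        (scale (\<Sum>i\<in>Poly_Mapping.keys b. Poly_Mapping.lookup b i * of_int (Poly_Mapping.lookup n i)) (Poly_Mapping.lookup u n)))"

fun tor_bracket ::
  "(complex \<Rightarrow> 'g \<Rightarrow> 'g) \<Rightarrow> ('g \<Rightarrow> 'g \<Rightarrow> 'g) \<Rightarrow> ('g \<Rightarrow> 'g \<Rightarrow> complex) \<Rightarrow>
   'g tor \<Rightarrow> 'g tor \<Rightarrow> 'g::ab_group_add tor" where
  "tor_bracket scale bracket B (u, a, b) (u', a', b') =
     ((\<Sum>n\<in>Poly_Mapping.keys u. \<Sum>m\<in>Poly_Mapping.keys u'. Poly_Mapping.single (n + m) (bracket (Poly_Mapping.lookup u n) (Poly_Mapping.lookup u' m)))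
        + tor_derivation scale b u' - tor_derivation scale b' u,
      (\<Sum>n\<in>Poly_Mapping.keys u. \<Sum>m\<in>Poly_Mapping.keys u'.
         if n + m = 0 then Poly_Mapping.map (\<lambda>j. B (Poly_Mapping.lookup u n) (Poly_Mapping.lookup u' m) * of_int j) n else 0),
      0)"

definition toroidal :: "nat \<Rightarrow> 'g::ab_group_add tor set" where
  "toroidal k = {(u, a, b). (\<forall>n\<in>Poly_Mapping.keys u. Poly_Mapping.keys n \<subseteq> {1..k}) \<and>
     Poly_Mapping.keys a \<subseteq> {1..k} \<and> Poly_Mapping.keys b \<subseteq> {1..k}}"

definition toroidal_minus :: "nat \<Rightarrow> 'g::ab_group_add tor set" where
  "toroidal_minus k = {(u, a, b). (\<forall>n\<in>Poly_Mapping.keys u. Poly_Mapping.keys n \<subseteq> {1..k} \<and>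
     Poly_Mapping.lookup n k \<le> -1) \<and> a = 0 \<and> b = 0}"

end

theory Submission
  imports Defs "HOL-Library.Function_Algebras"
begin

text \<open>
  Let \<open>d \<ge> 1\<close> be the degree of \<open>Z\<close> in the standard filtration of \<open>U(\<gg>\<^sub>k\<^sup>-)\<close>.  On the symbol of
  \<open>Z\<close>, a polynomial of degree \<open>d\<close> in the variables \<open>y \<otimes> t\<^sup>n\<close>, the commutator with
  \<open>x \<otimes> t\<^sup>e\<close>, where \<open>e\<close> is \<open>r\<close> times the unit vector in direction \<open>k - 1\<close>, acts as the derivation
  \<open>y \<otimes> t\<^sup>n \<mapsto> [x, y] \<otimes> t\<^sup>n\<^sup>+\<^sup>e\<close>.  The central term is absent because the exponent of \<open>t\<^sub>k\<close> in \<open>n\<close> is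
  negative and \<open>e\<close> leaves it unchanged.  If \<open>r\<close> is large then no exponent \<open>n + e\<close> occurs in \<open>Z\<close>, so
  the contributions of the different exponents \<open>n\<close> cannot cancel; as \<open>\<gg>\<close> has trivial centre, some
  \<open>x\<close> yields a non-zero result.

  This argument needs to know that a symbol is well defined and that a non-zero symbol forces an
  element of \<open>U\<close> to be non-zero.  Both are obtained by duality, without a basis of \<open>U\<close>.  A linear
  functional on \<open>U(L)\<close> is a complex-valued function on words over \<open>L\<close> that respects the relations of
  \<open>U(L)\<close>.  Such functionals are multiplied by the transpose \<open>conv\<close> of the coproduct.  A product of \<open>d\<close>
  functionals vanishing on the empty word kills all words of length less than \<open>d\<close>, and on words of
  length \<open>d\<close> it is the sum, over all bijections between factors and letters, of the products of the
  values of the factors on single letters (\<open>convs_vanishes\<close>, \<open>convs_leading\<close>).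
  So it evaluates the symbol of an element of degree \<open>d\<close>.  The commutator with a letter is a
  derivation for this product (\<open>ad_functional_conv\<close>).

  Two facts are then combined.  First, \<open>exists_nonzero_slots\<close>: a non-constant \<open>Z\<close> is represented by
  some \<open>a\<close> with words of length at most \<open>d\<close> on which a product of \<open>d\<close> coordinate functionals, the
  \<open>i\<close>-th of them reading a coefficient at an exponent \<open>n\<^sub>i\<close>, does not vanish.  The reason is that \<open>a\<close>
  lies outside the sum of the ideal and the span of the shorter words.  A linear functional that
  separates \<open>a\<close> from this subspace is multilinear and symmetric on words of length \<open>d\<close>, hence by
  polarisation a combination of such products.  Second, functionals of the form
  \<open>y \<otimes> t\<^sup>n \<mapsto> \<eta> [y, z]\<close> with \<open>n \<noteq> 0\<close> extend to \<open>U(\<gg>\<^sub>k)\<close>: they are matrix coefficients of the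
  representation of the toroidal algebra on \<open>\<gg>\<close>-valued functions of the exponent, on which the centre
  acts by zero.  Since the centre of \<open>\<gg>\<close> is trivial, the coordinate functionals can be exchanged one
  by one for functionals of this form (\<open>slots_realizable\<close>), and the first one for
  \<open>y \<otimes> t\<^sup>n \<mapsto> \<eta> [[x, y], z]\<close>, which is what the commutator with \<open>x \<otimes> t\<^sup>e\<close> makes of a matrix
  coefficient at the exponent \<open>n + e\<close>.  The product of the resulting matrix coefficients is a
  functional on \<open>U(\<gg>\<^sub>k)\<close> that is non-zero on the commutator
  (\<open>ad_convs_matrix_coefficients\<close>).\<close>

section \<open>Convolution of functions on words\<close>

text \<open>The transpose of the coproduct that makes every letter primitive: the value of the product on a word
is the sum, over all ways to split the word into two complementary subwords, of the value of \<open>f\<close> on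
the first times the value of \<open>g\<close> on the second.  The recursion decides where the first letter goes.
It runs on the word, with \<open>f\<close> and \<open>g\<close> varying; \<open>conv\<close> below only puts the word last.\<close>

primrec unshuffle_conv :: "'l list \<Rightarrow> ('l list \<Rightarrow> complex) \<Rightarrow> ('l list \<Rightarrow> complex) \<Rightarrow> complex" where
  "unshuffle_conv [] f g = f [] * g []"
| "unshuffle_conv (x # w) f g =
     unshuffle_conv w (\<lambda>u. f (x # u)) g + unshuffle_conv w f (\<lambda>u. g (x # u))"

definition conv :: "('l list \<Rightarrow> complex) \<Rightarrow> ('l list \<Rightarrow> complex) \<Rightarrow> 'l list \<Rightarrow> complex" where
  "conv f g w = unshuffle_conv w f g"

lemma conv_Nil [simp]: "conv f g [] = f [] * g []"
  and conv_Cons: "conv f g (x # w) = conv (\<lambda>u. f (x # u)) g w + conv f (\<lambda>u. g (x # u)) w"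
  by (simp_all add: conv_def)

lemma conv_snoc: "conv f g (w @ [x]) = conv (\<lambda>u. f (u @ [x])) g w + conv f (\<lambda>u. g (u @ [x])) w"
  by (induction w arbitrary: f g) (simp_all add: conv_Cons algebra_simps)

lemma conv_add_left: "conv (\<lambda>u. f u + f' u) g w = conv f g w + conv f' g w"
  and conv_add_right: "conv g (\<lambda>u. f u + f' u) w = conv g f w + conv g f' w"
  by (induction w arbitrary: f f' g) (simp_all add: conv_Cons algebra_simps)

lemma conv_diff_left: "conv (\<lambda>u. f u - f' u) g w = conv f g w - conv f' g w"
  and conv_diff_right: "conv g (\<lambda>u. f u - f' u) w = conv g f w - conv g f' w"
  by (induction w arbitrary: f f' g) (simp_all add: conv_Cons algebra_simps)

lemma conv_scale_left: "conv (\<lambda>u. c * f u) g w = c * conv f g w"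
  and conv_scale_right: "conv g (\<lambda>u. c * f u) w = c * conv g f w"
  by (induction w arbitrary: f g) (simp_all add: conv_Cons algebra_simps)

text \<open>In each splitting of a word of length less than \<open>m + n\<close>, either the first part is shorter than \<open>m\<close>
or the second is shorter than \<open>n\<close>.\<close>

lemma conv_vanishes:
  assumes "\<And>u. \<lbrakk>u \<in> lists A; length u < m\<rbrakk> \<Longrightarrow> f u = 0"
    and "\<And>u. \<lbrakk>u \<in> lists A; length u < n\<rbrakk> \<Longrightarrow> g u = 0"
    and "w \<in> lists A" and "length w < m + n"
  shows "conv f g w = 0"
  using assms
proof (induction w arbitrary: f g m n)
  case Nil
  then show ?case by (cases m) auto
next
  case (Cons x w)
  have "conv (\<lambda>u. f (x # u)) g w = 0"
    by (rule Cons.IH[of "m - 1" _ n]) (use Cons.prems in auto)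
  moreover have "conv f (\<lambda>u. g (x # u)) w = 0"
    by (rule Cons.IH[of m _ "n - 1"]) (use Cons.prems in auto)
  ultimately show ?case by (simp add: conv_Cons)
qed

definition convs :: "('l list \<Rightarrow> complex) list \<Rightarrow> 'l list \<Rightarrow> complex" where
  "convs fs = foldr conv fs (\<lambda>w. if w = [] then 1 else 0)"

lemma convs_Nil [simp]: "convs [] w = (if w = [] then 1 else 0)"
  and convs_Cons [simp]: "convs (f # fs) = conv f (convs fs)"
  by (simp_all add: convs_def)

lemma convs_vanishes:
  assumes "\<And>f. f \<in> set fs \<Longrightarrow> f [] = 0" and "length w < length fs"
  shows "convs fs w = 0"
  using assms
proof (induction fs arbitrary: w)
  case (Cons f fs)
  show ?case unfolding convs_Cons
    by (rule conv_vanishes[where A = UNIV and m = 1 and n = "length fs"]) (use Cons in auto)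
qed simp

text \<open>A functional supported on words of one letter.  For linear \<open>\<psi>\<close>, products of these are functionals on
the symmetric algebra, and describe the leading terms of functionals on an enveloping algebra.\<close>

definition letter_functional :: "('l \<Rightarrow> complex) \<Rightarrow> 'l list \<Rightarrow> complex" where
  "letter_functional \<psi> w = (case w of [x] \<Rightarrow> \<psi> x | _ \<Rightarrow> 0)"

lemma letter_functional_simps [simp]:
  "letter_functional \<psi> [] = 0" "letter_functional \<psi> [x] = \<psi> x"
  "letter_functional \<psi> (x # y # w) = 0"
  by (simp_all add: letter_functional_def)

lemma conv_zero_left [simp]: "conv (\<lambda>u. 0) g w = 0"
  by (induction w arbitrary: g) (simp_all add: conv_Cons)

lemma conv_unit_left: "conv (\<lambda>u. if u = [] then c else 0) g w = c * g w"
  by (induction w arbitrary: g) (simp_all add: conv_Cons)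

lemma conv_letter_functional:
  "conv (letter_functional \<psi>) g w =
     (\<Sum>j<length w. \<psi> (w ! j) * g (take j w @ drop (Suc j) w))"
proof (induction w arbitrary: g)
  case (Cons x w)
  have "(\<lambda>u. letter_functional \<psi> (x # u)) = (\<lambda>u. if u = [] then \<psi> x else 0)"
    by (auto simp: letter_functional_def split: list.splits)
  then have "conv (letter_functional \<psi>) g (x # w) = \<psi> x * g w +
      (\<Sum>j<length w. \<psi> (w ! j) * g (x # take j w @ drop (Suc j) w))"
    by (simp only: conv_Cons conv_unit_left Cons.IH)
  also have "\<dots> = (\<Sum>j<Suc (length w). \<psi> ((x # w) ! j) * g (take j (x # w) @ drop (Suc j) (x # w)))"
    by (subst sum.lessThan_Suc_shift) simp
  finally show ?case by simp
qed simp

text \<open>On words of the lowest degree \<open>m + n\<close> a product depends only on the lowest-degree parts of its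
factors: telescoping the difference of both products leaves terms that vanish up to length
\<open>m + n\<close> by \<open>conv_vanishes\<close>.\<close>

lemma conv_leading_cong:
  assumes f: "\<And>u. \<lbrakk>u \<in> lists A; length u \<le> m\<rbrakk> \<Longrightarrow> f u = f' u"
    and g: "\<And>u. \<lbrakk>u \<in> lists A; length u \<le> n\<rbrakk> \<Longrightarrow> g u = g' u"
    and f0: "\<And>u. \<lbrakk>u \<in> lists A; length u < m\<rbrakk> \<Longrightarrow> f u = 0"
    and g0: "\<And>u. \<lbrakk>u \<in> lists A; length u < n\<rbrakk> \<Longrightarrow> g u = 0"
    and w: "w \<in> lists A" "length w \<le> m + n"
  shows "conv f g w = conv f' g' w"
proof -
  have "conv f g w - conv f' g' w = conv (\<lambda>u. f u - f' u) g w + conv f' (\<lambda>u. g u - g' u) w"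
    by (simp add: conv_diff_left conv_diff_right)
  also have "conv (\<lambda>u. f u - f' u) g w = 0"
    by (rule conv_vanishes[where A = A and m = "Suc m" and n = n]) (use assms in auto)
  also have "conv f' (\<lambda>u. g u - g' u) w = 0"
    by (rule conv_vanishes[where A = A and m = m and n = "Suc n"])
      (use f g w f0 in \<open>auto simp: less_imp_le simp flip: f\<close>)
  finally show ?thesis by simp
qed

text \<open>The lowest-degree part of a product is computed from the linear parts of the factors; this is how a
functional on an enveloping algebra sees the symbol of an element.\<close>

lemma convs_leading:
  assumes "\<And>f. f \<in> set fs \<Longrightarrow> f [] = 0" and "length w \<le> length fs"
  shows "convs fs w = convs (map (\<lambda>f. letter_functional (\<lambda>x. f [x])) fs) w"
  using assms
proof (induction fs arbitrary: w)
  case (Cons f fs)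
  have *: "u = [] \<or> (\<exists>x. u = [x])" if "length u \<le> Suc 0" for u :: "'a list"
    using that by (cases u) auto
  show ?case unfolding convs_Cons list.map
    by (rule conv_leading_cong[where A = UNIV and m = 1 and n = "length fs"])
      (use Cons convs_vanishes[of fs] * in \<open>fastforce+\<close>)
qed simp

section \<open>Commutators with a letter, seen on functionals\<close>

text \<open>The transpose of the commutator with the letter \<open>x\<close>.\<close>

definition ad_functional :: "'l \<Rightarrow> ('l list \<Rightarrow> complex) \<Rightarrow> 'l list \<Rightarrow> complex" where
  "ad_functional x f w = f (x # w) - f (w @ [x])"

text \<open>A primitive element acts on products of functionals by a derivation.\<close>

lemma ad_functional_conv:
  "ad_functional x (conv f g) w = conv (ad_functional x f) g w + conv f (ad_functional x g) w"
  unfolding ad_functional_def by (simp add: conv_Cons conv_snoc conv_diff_left conv_diff_right)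

lemma ad_functional_convs_vanishes:
  assumes "\<And>f. f \<in> set fs \<Longrightarrow> f [] = 0"
    and "\<And>f y. f \<in> set fs \<Longrightarrow> y \<in> A \<Longrightarrow> ad_functional x f [y] = 0"
    and "w \<in> lists A" and "length w \<le> length fs"
  shows "ad_functional x (convs fs) w = 0"
  using assms
proof (induction fs arbitrary: w)
  case Nil
  then show ?case by (simp add: ad_functional_def)
next
  case (Cons f fs)
  have "conv (ad_functional x f) (convs fs) w = 0"
  proof (rule conv_vanishes[where A = A and m = 2 and n = "length fs"])
    fix u assume "u \<in> lists A" "length u < 2"
    then consider "u = []" | y where "u = [y]" "y \<in> A"
      by (cases u) auto
    then show "ad_functional x f u = 0"
      by cases (use Cons.prems in \<open>auto simp: ad_functional_def\<close>)
  qed (use Cons.prems convs_vanishes[of fs] in auto)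
  moreover have "conv f (ad_functional x (convs fs)) w = 0"
    by (rule conv_vanishes[where A = A and m = 1 and n = "Suc (length fs)"])
      (use Cons in auto)
  ultimately show ?case by (simp add: ad_functional_conv)
qed

text \<open>By the derivation rule, the commutator replaces one factor at a time.  If it annihilates the linear
parts of all factors but the first, only the term for the first factor survives in lowest degree.\<close>

lemma ad_functional_convs_leading:
  assumes f: "f [] = 0" and fs: "\<And>g. g \<in> set fs \<Longrightarrow> g [] = 0"
    and \<psi>: "\<And>y. y \<in> A \<Longrightarrow> ad_functional x f [y] = \<psi> y"
    and ad0: "\<And>g y. g \<in> set fs \<Longrightarrow> y \<in> A \<Longrightarrow> ad_functional x g [y] = 0"
    and w: "w \<in> lists A" "length w \<le> Suc (length fs)"
  shows "ad_functional x (convs (f # fs)) w =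
    convs (letter_functional \<psi> # map (\<lambda>f. letter_functional (\<lambda>x. f [x])) fs) w"
proof -
  have "conv f (ad_functional x (convs fs)) w = 0"
    by (rule conv_vanishes[where A = A and m = 1 and n = "Suc (length fs)"])
      (use assms ad_functional_convs_vanishes[of fs A x] in auto)
  then have "ad_functional x (convs (f # fs)) w = conv (ad_functional x f) (convs fs) w"
    by (simp add: ad_functional_conv)
  also have "\<dots> = conv (letter_functional \<psi>) (convs (map (\<lambda>f. letter_functional (\<lambda>x. f [x])) fs)) w"
  proof (rule conv_leading_cong[where A = A and m = 1 and n = "length fs"])
    fix u assume u: "u \<in> lists A"
    show "ad_functional x f u = letter_functional \<psi> u" if "length u \<le> 1"
      using that u \<psi> by (cases u) (auto simp: ad_functional_def)
    show "ad_functional x f u = 0" if "length u < 1"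
      using that by (simp add: ad_functional_def)
    show "convs fs u = convs (map (\<lambda>f. letter_functional (\<lambda>x. f [x])) fs) u" if "length u \<le> length fs"
      using convs_leading[of fs u] fs that by blast
    show "convs fs u = 0" if "length u < length fs"
      using convs_vanishes[of fs u] fs that by blast
  qed (use w in auto)
  finally show ?thesis by simp
qed

section \<open>Functionals on an enveloping algebra\<close>

text \<open>The functions on words whose linear extensions to the free algebra annihilate the relations of the
enveloping algebra and their multiples by words from both sides.\<close>

definition enveloping_functional ::
  "(complex \<Rightarrow> 'l \<Rightarrow> 'l) \<Rightarrow> ('l \<Rightarrow> 'l \<Rightarrow> 'l::ab_group_add) \<Rightarrow> ('l list \<Rightarrow> complex) \<Rightarrow> bool" where
  "enveloping_functional scale bracket f \<longleftrightarrow>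
     (\<forall>u v x y. f (u @ (x + y) # v) = f (u @ x # v) + f (u @ y # v)) \<and>
     (\<forall>u v c x. f (u @ scale c x # v) = c * f (u @ x # v)) \<and>
     (\<forall>u v x y. f (u @ x # y # v) - f (u @ y # x # v) = f (u @ bracket x y # v))"

lemma enveloping_functionalD:
  assumes "enveloping_functional scale bracket f"
  shows "f (u @ (x + y) # v) = f (u @ x # v) + f (u @ y # v)"
    and "f (u @ scale c x # v) = c * f (u @ x # v)"
    and "f (u @ x # y # v) - f (u @ y # x # v) = f (u @ bracket x y # v)"
  using assms by (auto simp: enveloping_functional_def)

lemma enveloping_functional_Cons:
  assumes "enveloping_functional scale bracket f"
  shows "enveloping_functional scale bracket (\<lambda>u. f (x # u))"
  unfolding enveloping_functional_def
  using assms[THEN enveloping_functionalD(1), of "x # _"]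
    assms[THEN enveloping_functionalD(2), of "x # _"]
    assms[THEN enveloping_functionalD(3), of "x # _"] by auto

text \<open>The coproduct respects the relations of the enveloping algebra because letters are primitive.  For
the commutation relation, the two terms of \<open>xy\<close> in which \<open>x\<close> and \<open>y\<close> go to different factors
also occur in \<open>yx\<close> and cancel.\<close>

lemma enveloping_functional_conv:
  assumes "enveloping_functional scale bracket f" "enveloping_functional scale bracket g"
  shows "enveloping_functional scale bracket (conv f g)"
  unfolding enveloping_functional_def
proof (intro conjI allI)
  fix u v x y
  show "conv f g (u @ (x + y) # v) = conv f g (u @ x # v) + conv f g (u @ y # v)"
    using assms
  proof (induction u arbitrary: f g)
    case Nil
    show ?case
      using enveloping_functionalD(1)[OF Nil(1), of "[]"] enveloping_functionalD(1)[OF Nil(2), of "[]"]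
      by (simp add: conv_Cons conv_add_left conv_add_right)
  qed (simp add: conv_Cons enveloping_functional_Cons)
next
  fix u v c x
  show "conv f g (u @ scale c x # v) = c * conv f g (u @ x # v)"
    using assms
  proof (induction u arbitrary: f g)
    case Nil
    show ?case
      using enveloping_functionalD(2)[OF Nil(1), of "[]"] enveloping_functionalD(2)[OF Nil(2), of "[]"]
      by (simp add: conv_Cons conv_scale_left conv_scale_right distrib_left)
  qed (simp add: conv_Cons enveloping_functional_Cons distrib_left)
next
  fix u v x y
  show "conv f g (u @ x # y # v) - conv f g (u @ y # x # v) = conv f g (u @ bracket x y # v)"
    using assms
  proof (induction u arbitrary: f g)
    case Nil
    have "(\<lambda>w. f (bracket x y # w)) = (\<lambda>w. f (x # y # w) - f (y # x # w))"
      "(\<lambda>w. g (bracket x y # w)) = (\<lambda>w. g (x # y # w) - g (y # x # w))"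
      using enveloping_functionalD(3)[OF Nil(1), of "[]"] enveloping_functionalD(3)[OF Nil(2), of "[]"]
      by simp_all
    then show ?case
      by (simp add: conv_Cons conv_diff_left conv_diff_right)
  next
    case (Cons z u)
    show ?case
      using Cons.IH[OF enveloping_functional_Cons[OF Cons.prems(1), of z] Cons.prems(2)]
        Cons.IH[OF Cons.prems(1) enveloping_functional_Cons[OF Cons.prems(2), of z]]
      by (simp add: conv_Cons algebra_simps)
  qed
qed

lemma enveloping_functional_convs:
  assumes "\<And>f. f \<in> set fs \<Longrightarrow> enveloping_functional scale bracket f"
  shows "enveloping_functional scale bracket (convs fs)"
  using assms
proof (induction fs)
  case Nil
  show ?case by (simp add: enveloping_functional_def)
qed (simp add: enveloping_functional_conv)

section \<open>The free algebra as a ring\<close>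

lemma free_algebra_carrier:
  "f \<in> carrier (free_algebra L) \<longleftrightarrow> finite {w. f w \<noteq> 0} \<and> {w. f w \<noteq> 0} \<subseteq> lists L"
  by (simp add: free_algebra_def)

lemma free_algebra_add [simp]: "f \<oplus>\<^bsub>free_algebra L\<^esub> g = (\<lambda>w. f w + g w)"
  and free_algebra_zero [simp]: "\<zero>\<^bsub>free_algebra L\<^esub> = (\<lambda>w. 0)"
  and free_algebra_one: "\<one>\<^bsub>free_algebra L\<^esub> = free_scalar 1"
  by (simp_all add: free_algebra_def free_scalar_def)

lemma free_algebra_mult_Nil [simp]: "(f \<otimes>\<^bsub>free_algebra L\<^esub> g) [] = f [] * g []"
  by (simp add: free_algebra_def)

text \<open>Splitting off the first letter gives a recursion for the product, which spares the reindexing of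
double sums in the ring laws below.\<close>

lemma free_algebra_mult_Cons:
  "(f \<otimes>\<^bsub>free_algebra L\<^esub> g) (x # w) = f [] * g (x # w) + ((\<lambda>u. f (x # u)) \<otimes>\<^bsub>free_algebra L\<^esub> g) w"
  by (simp add: free_algebra_def sum.atMost_Suc_shift del: sum.atMost_Suc)

lemma free_algebra_mult_add_left:
  "((\<lambda>u. f u + f' u) \<otimes>\<^bsub>free_algebra L\<^esub> g) w = (f \<otimes>\<^bsub>free_algebra L\<^esub> g) w + (f' \<otimes>\<^bsub>free_algebra L\<^esub> g) w"
  and free_algebra_mult_add_right:
  "(g \<otimes>\<^bsub>free_algebra L\<^esub> (\<lambda>u. f u + f' u)) w = (g \<otimes>\<^bsub>free_algebra L\<^esub> f) w + (g \<otimes>\<^bsub>free_algebra L\<^esub> f') w"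
  and free_algebra_mult_scale_left:
  "((\<lambda>u. c * f u) \<otimes>\<^bsub>free_algebra L\<^esub> g) w = c * (f \<otimes>\<^bsub>free_algebra L\<^esub> g) w"
  by (induction w arbitrary: f f' g) (simp_all add: free_algebra_mult_Cons algebra_simps)

lemma free_algebra_mult_scale_right:
  "(g \<otimes>\<^bsub>free_algebra L\<^esub> (\<lambda>u. c * f u)) w = c * (g \<otimes>\<^bsub>free_algebra L\<^esub> f) w"
  by (induction w arbitrary: g) (simp_all add: free_algebra_mult_Cons algebra_simps)

lemma free_algebra_mult_assoc:
  "((f \<otimes>\<^bsub>free_algebra L\<^esub> g) \<otimes>\<^bsub>free_algebra L\<^esub> h) w = (f \<otimes>\<^bsub>free_algebra L\<^esub> (g \<otimes>\<^bsub>free_algebra L\<^esub> h)) w"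
  by (induction w arbitrary: f g)
    (simp_all add: free_algebra_mult_Cons free_algebra_mult_add_left free_algebra_mult_scale_left
      algebra_simps)

lemma free_algebra_mult_zero_left: "((\<lambda>u. 0) \<otimes>\<^bsub>free_algebra L\<^esub> g) w = 0"
  by (simp add: free_algebra_def)

lemma free_scalar_mult: "free_scalar c \<otimes>\<^bsub>free_algebra L\<^esub> g = (\<lambda>w. c * g w)"
proof
  fix w show "(free_scalar c \<otimes>\<^bsub>free_algebra L\<^esub> g) w = c * g w"
    by (cases w) (simp_all add: free_scalar_def free_algebra_mult_Cons free_algebra_mult_zero_left)
qed

lemma mult_free_scalar: "g \<otimes>\<^bsub>free_algebra L\<^esub> free_scalar c = (\<lambda>w. g w * c)"
proof
  fix w show "(g \<otimes>\<^bsub>free_algebra L\<^esub> free_scalar c) w = g w * c"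
    by (induction w arbitrary: g) (simp_all add: free_scalar_def free_algebra_mult_Cons)
qed

lemma free_algebra_support_mult:
  "{w. (f \<otimes>\<^bsub>free_algebra L\<^esub> g) w \<noteq> 0} \<subseteq> (\<lambda>(u, v). u @ v) ` ({w. f w \<noteq> 0} \<times> {w. g w \<noteq> 0})"
proof
  fix w assume "w \<in> {w. (f \<otimes>\<^bsub>free_algebra L\<^esub> g) w \<noteq> 0}"
  then obtain i where "i \<le> length w" "f (take i w) * g (drop i w) \<noteq> 0"
    by (auto simp: free_algebra_def elim: sum.not_neutral_contains_not_neutral)
  then show "w \<in> (\<lambda>(u, v). u @ v) ` ({w. f w \<noteq> 0} \<times> {w. g w \<noteq> 0})"
    by (intro image_eqI[of _ _ "(take i w, drop i w)"]) auto
qed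

lemma free_algebra_mult_closed:
  assumes "f \<in> carrier (free_algebra L)" "g \<in> carrier (free_algebra L)"
  shows "f \<otimes>\<^bsub>free_algebra L\<^esub> g \<in> carrier (free_algebra L)"
proof -
  let ?P = "(\<lambda>(u, v). u @ v) ` ({w. f w \<noteq> 0} \<times> {w. g w \<noteq> 0})"
  have "finite ?P"
    using assms by (simp add: free_algebra_carrier)
  moreover have "?P \<subseteq> lists L"
  proof
    fix w assume "w \<in> ?P"
    then obtain u v where "w = u @ v" "f u \<noteq> 0" "g v \<noteq> 0" by auto
    then show "w \<in> lists L"
      using assms unfolding free_algebra_carrier
      by (metis (mono_tags) append_in_lists_conv mem_Collect_eq subsetD)
  qed
  ultimately  show ?thesis
    using free_algebra_support_mult[of L f g]
    unfolding free_algebra_carrier by (meson finite_subset subset_trans)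
qed

lemma free_algebra_combination_closed:
  assumes "f \<in> carrier (free_algebra L)" "g \<in> carrier (free_algebra L)"
  shows "(\<lambda>w. c * f w + d * g w) \<in> carrier (free_algebra L)"
proof -
  have "{w. c * f w + d * g w \<noteq> 0} \<subseteq> {w. f w \<noteq> 0} \<union> {w. g w \<noteq> 0}" by auto
  then show ?thesis
    using assms by (auto simp: free_algebra_carrier intro: finite_subset)
qed

lemma free_scalar_closed: "free_scalar c \<in> carrier (free_algebra L)"
proof -
  have "{w. free_scalar c w \<noteq> 0} \<subseteq> {[]}" by (auto simp: free_scalar_def)
  then show ?thesis by (auto simp: free_algebra_carrier intro: finite_subset)
qed

lemma ring_free_algebra: "ring (free_algebra L)"
proof (rule ringI)
  show "abelian_group (free_algebra L)"
  proof (rule abelian_groupI)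
    fix f assume f: "f \<in> carrier (free_algebra L)"
    show "\<exists>g\<in>carrier (free_algebra L). g \<oplus>\<^bsub>free_algebra L\<^esub> f = \<zero>\<^bsub>free_algebra L\<^esub>"
      using free_algebra_combination_closed[OF f f, of "-1" 0]
      by (intro bexI[of _ "\<lambda>w. - f w"]) simp_all
  next
    show "\<zero>\<^bsub>free_algebra L\<^esub> \<in> carrier (free_algebra L)"
      by (simp add: free_algebra_carrier)
  next
    fix f g assume "f \<in> carrier (free_algebra L)" "g \<in> carrier (free_algebra L)"
    then show "f \<oplus>\<^bsub>free_algebra L\<^esub> g \<in> carrier (free_algebra L)"
      using free_algebra_combination_closed[of f L g 1 1] by simp
  qed (simp_all add: add.assoc add.commute add.left_commute)
  show "Group.monoid (free_algebra L)"
    by (rule Group.monoidI)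
      (auto simp: free_algebra_one free_scalar_mult mult_free_scalar free_scalar_closed
        free_algebra_mult_assoc intro: free_algebra_mult_closed)
qed (simp_all add: fun_eq_iff free_algebra_mult_add_left free_algebra_mult_add_right)

interpretation free_algebra: ring "free_algebra L" for L
  by (rule ring_free_algebra)

lemma free_algebra_uminus:
  assumes "g \<in> carrier (free_algebra L)"
  shows "\<ominus>\<^bsub>free_algebra L\<^esub> g = (\<lambda>w. - g w)"
  using assms free_algebra_combination_closed[of g L g "-1" 0]
  by (intro free_algebra.minus_equality) simp_all

lemma free_algebra_minus:
  assumes "g \<in> carrier (free_algebra L)"
  shows "f \<ominus>\<^bsub>free_algebra L\<^esub> g = (\<lambda>w. f w - g w)"
  using assms by (simp add: a_minus_def free_algebra_uminus)

section \<open>Evaluating functionals on the free algebra\<close>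

definition word :: "'l list \<Rightarrow> 'l list \<Rightarrow> complex" where
  "word w = (\<lambda>v. if v = w then 1 else 0)"

lemma free_letter_eq_word: "free_letter x = word [x]"
  by (simp add: free_letter_def word_def)

lemma word_closed: "w \<in> lists L \<Longrightarrow> word w \<in> carrier (free_algebra L)"
  by (auto simp: free_algebra_carrier word_def)

definition evaluate :: "('l list \<Rightarrow> complex) \<Rightarrow> ('l list \<Rightarrow> complex) \<Rightarrow> complex" where
  "evaluate F a = (\<Sum>w | a w \<noteq> 0. a w * F w)"

lemma evaluate_superset:
  assumes "finite S" "{w. a w \<noteq> 0} \<subseteq> S"
  shows "evaluate F a = (\<Sum>w\<in>S. a w * F w)"
  unfolding evaluate_def by (rule sum.mono_neutral_left) (use assms in auto)

lemma evaluate_word [simp]: "evaluate F (word w) = F w"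
  using evaluate_superset[of "{w}" "word w"] by (simp add: word_def)

lemma evaluate_combination:
  assumes "f \<in> carrier (free_algebra L)" "g \<in> carrier (free_algebra L)"
  shows "evaluate F (\<lambda>w. c * f w + d * g w) = c * evaluate F f + d * evaluate F g"
proof -
  let ?S = "{w. f w \<noteq> 0} \<union> {w. g w \<noteq> 0}"
  have "finite ?S" using assms by (simp add: free_algebra_carrier)
  then show ?thesis
    by (subst (1 2 3) evaluate_superset[of ?S])
      (auto simp: algebra_simps sum.distrib sum_distrib_left)
qed

lemma evaluate_functional_combination:
  "evaluate (\<lambda>w. c * F w + d * G w) a = c * evaluate F a + d * evaluate G a"
  by (simp add: evaluate_def algebra_simps sum.distrib sum_distrib_left)

lemma evaluate_cong:
  assumes "\<And>w. a w \<noteq> 0 \<Longrightarrow> F w = G w"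
  shows "evaluate F a = evaluate G a"
  unfolding evaluate_def by (rule sum.cong) (use assms in auto)

lemma evaluate_mult:
  assumes f: "f \<in> carrier (free_algebra L)" and g: "g \<in> carrier (free_algebra L)"
  shows "evaluate F (f \<otimes>\<^bsub>free_algebra L\<^esub> g) = evaluate (\<lambda>u. evaluate (\<lambda>v. F (u @ v)) g) f"
proof -
  let ?f = "{w. f w \<noteq> 0}" and ?g = "{w. g w \<noteq> 0}"
  let ?S = "(\<lambda>(u, v). u @ v) ` (?f \<times> ?g)"
  \<comment> \<open>A pair of words is a word together with a cutting position; only positions with two non-zero
    coefficients contribute.\<close>
  let ?T = "{(w, i). i \<le> length w \<and> f (take i w) \<noteq> 0 \<and> g (drop i w) \<noteq> 0}"
  have fin: "finite ?f" "finite ?g" using assms by (simp_all add: free_algebra_carrier)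
  then have "finite ?S" by simp
  then have "evaluate F (f \<otimes>\<^bsub>free_algebra L\<^esub> g) =
      (\<Sum>w\<in>?S. \<Sum>i\<le>length w. f (take i w) * g (drop i w) * F w)"
    using free_algebra_support_mult[of L f g]
    by (subst evaluate_superset[of ?S]) (simp_all add: free_algebra_def sum_distrib_right)
  also have "\<dots> = (\<Sum>(w, i)\<in>(SIGMA w:?S. {..length w}). f (take i w) * g (drop i w) * F w)"
    by (rule sum.Sigma) (use \<open>finite ?S\<close> in auto)
  also have "\<dots> = (\<Sum>(w, i)\<in>?T. f (take i w) * g (drop i w) * F w)"
  proof (rule sum.mono_neutral_right)
    show "finite (SIGMA w:?S. {..length w})"
      using \<open>finite ?S\<close> by (intro finite_SigmaI) auto
    show "?T \<subseteq> (SIGMA w:?S. {..length w})" by (auto intro!: image_eqI[of _ _ "(take _ _, drop _ _)"])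
  qed auto
  also have "\<dots> = (\<Sum>(u, v)\<in>?f \<times> ?g. f u * g v * F (u @ v))"
    by (rule sum.reindex_bij_witness[of _ "\<lambda>(u, v). (u @ v, length u)" "\<lambda>(w, i). (take i w, drop i w)"])
      auto
  also have "\<dots> = (\<Sum>u\<in>?f. \<Sum>v\<in>?g. f u * g v * F (u @ v))"
    by (rule sum.Sigma[symmetric]) (use fin in auto)
  also have "\<dots> = evaluate (\<lambda>u. evaluate (\<lambda>v. F (u @ v)) g) f"
    by (simp add: evaluate_def sum_distrib_left mult.assoc)
  finally show ?thesis .
qed

lemma word_mult: "word u \<otimes>\<^bsub>free_algebra L\<^esub> word v = word (u @ v)"
proof
  fix w show "(word u \<otimes>\<^bsub>free_algebra L\<^esub> word v) w = word (u @ v) w"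
  proof (induction w arbitrary: u)
    case Nil
    show ?case by (auto simp: word_def)
  next
    case (Cons x w)
    show ?case
    proof (cases u)
      case Nil
      have "(\<lambda>ua. word [] (x # ua)) = (\<lambda>_. 0)" by (simp add: word_def)
      then show ?thesis using Nil
        by (simp add: free_algebra_mult_Cons free_algebra_mult_zero_left) (simp add: word_def)
    next
      case (Cons y u')
      have "(\<lambda>ua. word u (x # ua)) = (\<lambda>ua. (if x = y then 1 else 0) * word u' ua)"
        using Cons by (auto simp: word_def)
      then have "(word u \<otimes>\<^bsub>free_algebra L\<^esub> word v) (x # w) =
          (if x = y then 1 else 0) * word (u' @ v) w"
        using Cons Cons.IH[of u'] by (simp only: free_algebra_mult_Cons free_algebra_mult_scale_left)
          (simp add: word_def)
      then show ?thesis using Cons by (auto simp: word_def)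
    qed
  qed
qed

lemma evaluate_commutator_letter:
  assumes "x \<in> L" "a \<in> carrier (free_algebra L)"
  shows "evaluate F (commutator (free_algebra L) (free_letter x) a) = evaluate (ad_functional x F) a"
proof -
  let ?R = "free_algebra L"
  have x: "word [x] \<in> carrier ?R" using assms(1) by (simp add: word_closed)
  have "commutator ?R (free_letter x) a =
      (\<lambda>w. 1 * (word [x] \<otimes>\<^bsub>?R\<^esub> a) w + (-1) * (a \<otimes>\<^bsub>?R\<^esub> word [x]) w)"
    using x assms(2)
    by (simp add: commutator_def free_letter_eq_word free_algebra_minus free_algebra_mult_closed)
  then have "evaluate F (commutator ?R (free_letter x) a) =
      1 * evaluate F (word [x] \<otimes>\<^bsub>?R\<^esub> a) + (-1) * evaluate F (a \<otimes>\<^bsub>?R\<^esub> word [x])"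
    using x assms(2) by (simp only: evaluate_combination[where L = L] free_algebra_mult_closed)
  also have "\<dots> = 1 * evaluate (\<lambda>w. F (x # w)) a + (-1) * evaluate (\<lambda>w. F (w @ [x])) a"
    using x assms(2) by (simp add: evaluate_mult[where L = L])
  also have "\<dots> = evaluate (ad_functional x F) a"
    by (subst evaluate_functional_combination[symmetric]) (simp add: ad_functional_def[abs_def])
  finally show ?thesis .
qed

section \<open>Relations and ideals in the free algebra\<close>

text \<open>Multiplication by words on both sides.  The product does not depend on the set of letters, so the
full set serves for every \<open>L\<close>.\<close>

definition sandwich :: "'l list \<Rightarrow> 'l list \<Rightarrow> ('l list \<Rightarrow> complex) \<Rightarrow> 'l list \<Rightarrow> complex" where
  "sandwich u v f = word u \<otimes>\<^bsub>free_algebra UNIV\<^esub> f \<otimes>\<^bsub>free_algebra UNIV\<^esub> word v"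

lemma sandwich_combination:
  "sandwich u v (\<lambda>w. c * f w + d * g w) = (\<lambda>w. c * sandwich u v f w + d * sandwich u v g w)"
proof -
  have *: "word u \<otimes>\<^bsub>free_algebra UNIV\<^esub> (\<lambda>w. c * f w + d * g w) =
    (\<lambda>w. c * (word u \<otimes>\<^bsub>free_algebra UNIV\<^esub> f) w + d * (word u \<otimes>\<^bsub>free_algebra UNIV\<^esub> g) w)"
    by (simp add: fun_eq_iff free_algebra_mult_add_right free_algebra_mult_scale_right)
  show ?thesis
    unfolding sandwich_def * by (rule ext) (simp add: free_algebra_mult_add_left free_algebra_mult_scale_left)
qed

lemma sandwich_word: "sandwich u v (word w) = word (u @ w @ v)"
  by (simp add: sandwich_def word_mult)

lemma free_algebra_mult_eq: "(\<otimes>\<^bsub>free_algebra L\<^esub>) = (\<otimes>\<^bsub>free_algebra UNIV\<^esub>)"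
  by (simp add: free_algebra_def)

lemma ideal_free_algebraI:
  assumes "J \<subseteq> carrier (free_algebra L)" "(\<lambda>w. 0) \<in> J"
    and comb: "\<And>f g c d. \<lbrakk>f \<in> J; g \<in> J\<rbrakk> \<Longrightarrow> (\<lambda>w. c * f w + d * g w) \<in> J"
    and "\<And>f g. \<lbrakk>f \<in> J; g \<in> carrier (free_algebra L)\<rbrakk> \<Longrightarrow> f \<otimes>\<^bsub>free_algebra L\<^esub> g \<in> J"
    and "\<And>f g. \<lbrakk>f \<in> J; g \<in> carrier (free_algebra L)\<rbrakk> \<Longrightarrow> g \<otimes>\<^bsub>free_algebra L\<^esub> f \<in> J"
  shows "ideal J (free_algebra L)"
proof (rule idealI[OF ring_free_algebra])
  show "subgroup J (add_monoid (free_algebra L))"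
  proof (rule free_algebra.add.subgroupI)
    fix f assume f: "f \<in> J"
    have "\<ominus>\<^bsub>free_algebra L\<^esub> f = (\<lambda>w. (-1) * f w + 0 * f w)"
      using free_algebra_uminus[of f L] f assms(1) by auto
    then show "\<ominus>\<^bsub>free_algebra L\<^esub> f \<in> J" using comb[OF f f, of "-1" 0] by metis
  next
    fix f g assume "f \<in> J" "g \<in> J"
    from comb[OF this, of 1 1] show "f \<oplus>\<^bsub>free_algebra L\<^esub> g \<in> J" by simp
  qed (use assms in auto)
qed (use assms in auto)

locale lie_subset =
  fixes scale :: "complex \<Rightarrow> 'l::ab_group_add \<Rightarrow> 'l" and bracket :: "'l \<Rightarrow> 'l \<Rightarrow> 'l" and L :: "'l set"
  assumes add_closed: "\<lbrakk>x \<in> L; y \<in> L\<rbrakk> \<Longrightarrow> x + y \<in> L"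
    and scale_closed: "x \<in> L \<Longrightarrow> scale c x \<in> L"
    and bracket_closed: "\<lbrakk>x \<in> L; y \<in> L\<rbrakk> \<Longrightarrow> bracket x y \<in> L"
begin

abbreviation "I \<equiv> uea_ideal scale bracket L"

lemma relation_add:
  assumes "x \<in> L" "y \<in> L"
  shows "free_letter (x + y) \<ominus>\<^bsub>free_algebra L\<^esub> (free_letter x \<oplus>\<^bsub>free_algebra L\<^esub> free_letter y) =
    (\<lambda>w. 1 * word [x + y] w + (-1) * (1 * word [x] w + 1 * word [y] w))"
proof -
  have "(\<lambda>w. word [x] w + word [y] w) \<in> carrier (free_algebra L)"
    using free_algebra_combination_closed[OF word_closed word_closed, of "[x]" L "[y]" 1 1] assms by simp
  then show ?thesis
    using assms add_closed[OF assms]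
    by (simp add: free_letter_eq_word free_algebra_minus word_closed algebra_simps)
qed

lemma relation_scale:
  assumes "x \<in> L"
  shows "free_letter (scale c x) \<ominus>\<^bsub>free_algebra L\<^esub> (free_scalar c \<otimes>\<^bsub>free_algebra L\<^esub> free_letter x) =
    (\<lambda>w. 1 * word [scale c x] w + (-c) * word [x] w)"
proof -
  have "(\<lambda>w. c * word [x] w) \<in> carrier (free_algebra L)"
    using free_algebra_combination_closed[OF word_closed word_closed, of "[x]" L "[x]" c 0] assms by simp
  then show ?thesis
    using assms scale_closed[OF assms]
    by (simp add: free_letter_eq_word free_algebra_minus word_closed free_scalar_mult)
qed

lemma relation_bracket:
  assumes "x \<in> L" "y \<in> L"
  shows "commutator (free_algebra L) (free_letter x) (free_letter y)
      \<ominus>\<^bsub>free_algebra L\<^esub> free_letter (bracket x y) =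
    (\<lambda>w. 1 * (1 * word [x, y] w + (-1) * word [y, x] w) + (-1) * word [bracket x y] w)"
proof -
  have "(\<lambda>w. word [x, y] w - word [y, x] w) \<in> carrier (free_algebra L)"
    using free_algebra_combination_closed[OF word_closed word_closed, of "[x,y]" L "[y,x]" 1 "-1"] assms by simp
  then show ?thesis
    using assms bracket_closed[OF assms]
    by (simp add: commutator_def free_letter_eq_word free_algebra_minus word_closed word_mult)
qed

text \<open>The defining relations, written out in words.  The coefficients \<open>1\<close> and \<open>-1\<close> bring them into the form
to which the rules for linear combinations \<open>\<lambda>w. c * f w + d * g w\<close> apply.\<close>

lemma uea_relations_eq:
  "uea_relations scale bracket L =
     {(\<lambda>w. 1 * word [x + y] w + (-1) * (1 * word [x] w + 1 * word [y] w)) |x y. x \<in> L \<and> y \<in> L} \<union>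
     {(\<lambda>w. 1 * word [scale c x] w + (-c) * word [x] w) |c x. x \<in> L} \<union>
     {(\<lambda>w. 1 * (1 * word [x, y] w + (-1) * word [y, x] w) + (-1) * word [bracket x y] w)
        |x y. x \<in> L \<and> y \<in> L}"
  unfolding uea_relations_def
  by (intro arg_cong2[where f = "(\<union>)"] Collect_cong ex_cong1)
    (auto simp only: relation_add relation_scale relation_bracket)

lemma uea_relations_closed: "uea_relations scale bracket L \<subseteq> carrier (free_algebra L)"
  unfolding uea_relations_eq
  by (intro Un_least subsetI; elim CollectE exE conjE; simp only:)
    (intro free_algebra_combination_closed word_closed; simp add: add_closed scale_closed bracket_closed)+

lemma ideal_uea: "ideal I (free_algebra L)"
  unfolding uea_ideal_def by (rule free_algebra.genideal_ideal[OF uea_relations_closed])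

lemma uea_ideal_combination:
  assumes "f \<in> I" "g \<in> I"
  shows "(\<lambda>w. c * f w + d * g w) \<in> I"
proof -
  interpret ideal I "free_algebra L" by (rule ideal_uea)
  have "free_scalar c \<otimes>\<^bsub>free_algebra L\<^esub> f \<oplus>\<^bsub>free_algebra L\<^esub> free_scalar d \<otimes>\<^bsub>free_algebra L\<^esub> g \<in> I"
    by (intro a_closed I_l_closed assms free_scalar_closed)
  then show ?thesis by (simp add: free_scalar_mult)
qed

lemma sandwich_in_uea_ideal:
  assumes "f \<in> I" "u \<in> lists L" "v \<in> lists L"
  shows "sandwich u v f \<in> I"
proof -
  interpret ideal I "free_algebra L" by (rule ideal_uea)
  show ?thesis unfolding sandwich_def free_algebra_mult_eq[of L, symmetric]
    by (intro I_l_closed I_r_closed assms word_closed)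
qed

lemma uea_relations_in_ideal: "uea_relations scale bracket L \<subseteq> I"
  unfolding uea_ideal_def by (rule free_algebra.genideal_self[OF uea_relations_closed])

lemma sandwich_relations_in_ideal:
  assumes "u \<in> lists L" "v \<in> lists L" "x \<in> L"
  shows "y \<in> L \<Longrightarrow> (\<lambda>w. 1 * word (u @ (x + y) # v) w + (-1) * (1 * word (u @ x # v) w + 1 * word (u @ y # v) w)) \<in> I"
    and "(\<lambda>w. 1 * word (u @ scale c x # v) w + (-c) * word (u @ x # v) w) \<in> I"
    and "y \<in> L \<Longrightarrow> (\<lambda>w. 1 * (1 * word (u @ x # y # v) w + (-1) * word (u @ y # x # v) w) + (-1) * word (u @ bracket x y # v) w) \<in> I"
proof -
  show "(\<lambda>w. 1 * word (u @ (x + y) # v) w + (-1) * (1 * word (u @ x # v) w + 1 * word (u @ y # v) w)) \<in> I"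
    if "y \<in> L"
  proof -
    have "(\<lambda>w. 1 * word [x + y] w + (-1) * (1 * word [x] w + 1 * word [y] w)) \<in> I"
      using uea_relations_in_ideal assms that unfolding uea_relations_eq by blast
    from sandwich_in_uea_ideal[OF this assms(1,2)] show ?thesis
      by (simp only: sandwich_combination sandwich_word append_Cons append_Nil)
  qed
  show "(\<lambda>w. 1 * word (u @ scale c x # v) w + (-c) * word (u @ x # v) w) \<in> I"
  proof -
    have "(\<lambda>w. 1 * word [scale c x] w + (-c) * word [x] w) \<in> I"
      using uea_relations_in_ideal assms unfolding uea_relations_eq by blast
    from sandwich_in_uea_ideal[OF this assms(1,2)] show ?thesis
      by (simp only: sandwich_combination sandwich_word append_Cons append_Nil)
  qed
  show "(\<lambda>w. 1 * (1 * word (u @ x # y # v) w + (-1) * word (u @ y # x # v) w) + (-1) * word (u @ bracket x y # v) w) \<in> I"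
    if "y \<in> L"
  proof -
    have "(\<lambda>w. 1 * (1 * word [x, y] w + (-1) * word [y, x] w) + (-1) * word [bracket x y] w) \<in> I"
      using uea_relations_in_ideal assms that unfolding uea_relations_eq by blast
    from sandwich_in_uea_ideal[OF this assms(1,2)] show ?thesis
      by (simp only: sandwich_combination sandwich_word append_Cons append_Nil)
  qed
qed

text \<open>The elements all of whose two-sided multiples by words are annihilated by \<open>F\<close> form an ideal, and it
contains the relations.\<close>

lemma uea_ideal_annihilated:
  assumes F: "enveloping_functional scale bracket F" and "a \<in> I"
  shows "evaluate F a = 0"
proof -
  define J where "J = {a \<in> carrier (free_algebra L). \<forall>u v. evaluate (\<lambda>w. F (u @ w @ v)) a = 0}"
  have "ideal J (free_algebra L)"
  proof (rule ideal_free_algebraI)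
    show "(\<lambda>w. 0) \<in> J" by (simp add: J_def evaluate_def free_algebra_carrier)
  next
    fix f g c d assume "f \<in> J" "g \<in> J"
    then show "(\<lambda>w. c * f w + d * g w) \<in> J"
      by (simp add: J_def free_algebra_combination_closed evaluate_combination[where L = L])
  next
    fix f g assume f: "f \<in> J" and g: "g \<in> carrier (free_algebra L)"
    have "evaluate (\<lambda>w. F (u @ w @ v)) (g \<otimes>\<^bsub>free_algebra L\<^esub> f) = 0" for u v
    proof -
      have "evaluate (\<lambda>v'. F ((u @ u') @ v' @ v)) f = 0" for u'
        using f by (simp only: J_def mem_Collect_eq)
      then have "evaluate (\<lambda>v'. F (u @ u' @ v' @ v)) f = 0" for u' by simp
      then show ?thesis using f g by (simp add: J_def evaluate_mult) (simp add: evaluate_def)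
    qed
    then show "g \<otimes>\<^bsub>free_algebra L\<^esub> f \<in> J"
      using f g by (simp add: J_def free_algebra_mult_closed)
    have "evaluate (\<lambda>w. F (u @ w @ v)) (f \<otimes>\<^bsub>free_algebra L\<^esub> g) = 0" for u v
    proof -
      have "evaluate (\<lambda>w. F (u @ w @ v)) (f \<otimes>\<^bsub>free_algebra L\<^esub> g) =
        evaluate (\<lambda>u'. evaluate (\<lambda>v'. F (u @ u' @ v' @ v)) g) f"
        using f g by (simp add: J_def evaluate_mult)
      also have "\<dots> = evaluate (\<lambda>v'. evaluate (\<lambda>u'. F (u @ u' @ v' @ v)) f) g"
        unfolding evaluate_def sum_distrib_left by (subst sum.swap) (simp add: mult_ac)
      also have "\<dots> = 0" using f by (simp add: J_def) (simp add: evaluate_def)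
      finally show ?thesis .
    qed
    then show "f \<otimes>\<^bsub>free_algebra L\<^esub> g \<in> J"
      using f g by (simp add: J_def free_algebra_mult_closed)
  qed (auto simp: J_def)
  moreover have "uea_relations scale bracket L \<subseteq> J"
  proof
    fix f assume f: "f \<in> uea_relations scale bracket L"
    have "evaluate (\<lambda>w. F (u @ w @ v)) f = 0" for u v
    proof -
      let ?ev = "evaluate (\<lambda>w. F (u @ w @ v))"
      from f consider
        x y where "x \<in> L" "y \<in> L"
          "f = (\<lambda>w. 1 * word [x + y] w + (-1) * (1 * word [x] w + 1 * word [y] w))"
        | c x where "x \<in> L" "f = (\<lambda>w. 1 * word [scale c x] w + (-c) * word [x] w)"
        | x y where "x \<in> L" "y \<in> L"
          "f = (\<lambda>w. 1 * (1 * word [x, y] w + (-1) * word [y, x] w) + (-1) * word [bracket x y] w)"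
        unfolding uea_relations_eq by blast
      then show ?thesis
      proof cases
        case 1
        then have "?ev f = 1 * ?ev (word [x + y]) + (-1) * (1 * ?ev (word [x]) + 1 * ?ev (word [y]))"
          by (simp only: evaluate_combination[where L = UNIV] free_algebra_combination_closed word_closed lists_UNIV UNIV_I)
        then show ?thesis using enveloping_functionalD(1)[OF F] by simp
      next
        case 2
        then have "?ev f = 1 * ?ev (word [scale c x]) + (-c) * ?ev (word [x])"
          by (simp only: evaluate_combination[where L = UNIV] free_algebra_combination_closed word_closed lists_UNIV UNIV_I)
        then show ?thesis using enveloping_functionalD(2)[OF F] by simp
      next
        case 3
        then have "?ev f = 1 * (1 * ?ev (word [x, y]) + (-1) * ?ev (word [y, x])) + (-1) * ?ev (word [bracket x y])"
          by (simp only: evaluate_combination[where L = UNIV] free_algebra_combination_closed word_closed lists_UNIV UNIV_I)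
        then show ?thesis using enveloping_functionalD(3)[OF F, of u x y v] by simp
      qed
    qed
    then show "f \<in> J" using f uea_relations_closed by (auto simp: J_def)
  qed
  ultimately have "I \<subseteq> J"
    unfolding uea_ideal_def by (rule free_algebra.genideal_minimal)
  then have "evaluate (\<lambda>w. F ([] @ w @ [])) a = 0"
    using assms(2) unfolding J_def by blast
  then show ?thesis by simp
qed

end

text \<open>The ideal for \<open>L\<close> cuts out of the free algebra on \<open>M\<close> an ideal that contains the relations for \<open>M\<close>.\<close>

lemma uea_ideal_mono:
  assumes "lie_subset scale bracket M" "lie_subset scale bracket L" "M \<subseteq> L"
  shows "uea_ideal scale bracket M \<subseteq> uea_ideal scale bracket L"
proof -
  interpret M: lie_subset scale bracket M by fact
  interpret L: lie_subset scale bracket L by fact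
  interpret I: ideal L.I "free_algebra L" by (rule L.ideal_uea)
  have sub: "carrier (free_algebra M) \<subseteq> carrier (free_algebra L)"
  proof
    fix f assume "f \<in> carrier (free_algebra M)"
    then show "f \<in> carrier (free_algebra L)"
      using lists_mono[OF assms(3)] unfolding free_algebra_carrier by blast
  qed
  have mult: "f \<otimes>\<^bsub>free_algebra M\<^esub> g = f \<otimes>\<^bsub>free_algebra L\<^esub> g" for f g
    by (simp add: free_algebra_def)
  have "ideal (L.I \<inter> carrier (free_algebra M)) (free_algebra M)"
  proof (rule ideal_free_algebraI)
    show "(\<lambda>w. 0) \<in> L.I \<inter> carrier (free_algebra M)"
      using I.zero_closed by (simp add: free_algebra_carrier)
    show "(\<lambda>w. c * f w + d * g w) \<in> L.I \<inter> carrier (free_algebra M)"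
      if "f \<in> L.I \<inter> carrier (free_algebra M)" "g \<in> L.I \<inter> carrier (free_algebra M)" for f g c d
      using that by (simp add: L.uea_ideal_combination free_algebra_combination_closed)
    fix f g assume f: "f \<in> L.I \<inter> carrier (free_algebra M)" and g: "g \<in> carrier (free_algebra M)"
    then have "f \<otimes>\<^bsub>free_algebra M\<^esub> g \<in> L.I" "g \<otimes>\<^bsub>free_algebra M\<^esub> f \<in> L.I"
      unfolding mult using sub by (blast intro: I.I_r_closed I.I_l_closed)+
    then show "f \<otimes>\<^bsub>free_algebra M\<^esub> g \<in> L.I \<inter> carrier (free_algebra M)"
      "g \<otimes>\<^bsub>free_algebra M\<^esub> f \<in> L.I \<inter> carrier (free_algebra M)"
      using f g by (simp_all add: free_algebra_mult_closed)
  qed simp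
  moreover have "uea_relations scale bracket M \<subseteq> L.I \<inter> carrier (free_algebra M)"
  proof -
    have "uea_relations scale bracket M \<subseteq> uea_relations scale bracket L"
      unfolding M.uea_relations_eq L.uea_relations_eq using assms(3) by blast
    then show ?thesis using L.uea_relations_in_ideal M.uea_relations_closed by blast
  qed
  ultimately have "M.I \<subseteq> L.I \<inter> carrier (free_algebra M)"
    unfolding uea_ideal_def[of scale bracket M] by (rule free_algebra.genideal_minimal)
  then show ?thesis by blast
qed

lemma (in ideal) commutator_quotient_eq_zeroD:
  assumes "x \<in> carrier R" "y \<in> carrier R"
    and "commutator (R Quot I) (I +> x) (I +> y) = \<zero>\<^bsub>R Quot I\<^esub>"
  shows "commutator R x y \<in> I"
proof -
  interpret h: ring_hom_ring R "R Quot I" "(+>) I" by (rule rcos_ring_hom_ring)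
  have xy: "x \<otimes> y \<in> carrier R" "y \<otimes> x \<in> carrier R" using assms by auto
  have "I +> commutator R x y = commutator (R Quot I) (I +> x) (I +> y)"
    unfolding commutator_def a_minus_def
    by (simp only: h.hom_add[OF xy(1) a_inv_closed[OF xy(2)]] h.hom_a_inv[OF xy(2)]
        h.hom_mult[OF assms(1,2)] h.hom_mult[OF assms(2,1)])
  also have "\<dots> = \<zero>\<^bsub>R Quot I\<^esub>" by (rule assms(3))
  also have "\<dots> = I" unfolding FactRing_def ring.simps ..
  finally have "I +> commutator R x y = I" .
  moreover have "commutator R x y \<in> carrier R"
    unfolding commutator_def using xy by (rule minus_closed)
  ultimately show ?thesis using a_rcos_self[of "commutator R x y"] by simp
qed

text \<open>This identifies the image of a coset under the map of enveloping algebras induced by an inclusion.\<close>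

lemma set_add_rcos_ideal:
  assumes "ideal I R" "J \<subseteq> I" "\<zero>\<^bsub>R\<^esub> \<in> J" "a \<in> carrier R"
  shows "I <+>\<^bsub>R\<^esub> (J +>\<^bsub>R\<^esub> a) = I +>\<^bsub>R\<^esub> a"
proof -
  interpret ideal I R by fact
  show ?thesis
  proof
    show "I <+>\<^bsub>R\<^esub> (J +>\<^bsub>R\<^esub> a) \<subseteq> I +>\<^bsub>R\<^esub> a"
    proof
      fix z assume "z \<in> I <+>\<^bsub>R\<^esub> (J +>\<^bsub>R\<^esub> a)"
      then obtain i j where "i \<in> I" "j \<in> J" "z = i \<oplus>\<^bsub>R\<^esub> (j \<oplus>\<^bsub>R\<^esub> a)"
        by (auto simp: set_add_def' a_r_coset_def')
      moreover from this have "z = (i \<oplus>\<^bsub>R\<^esub> j) \<oplus>\<^bsub>R\<^esub> a"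
        using assms by (metis Icarr a_assoc subsetD)
      moreover have "i \<oplus>\<^bsub>R\<^esub> j \<in> I" using \<open>i \<in> I\<close> \<open>j \<in> J\<close> assms(2) by (auto intro: a_closed)
      ultimately show "z \<in> I +>\<^bsub>R\<^esub> a" unfolding a_r_coset_def' by blast
    qed
    show "I +>\<^bsub>R\<^esub> a \<subseteq> I <+>\<^bsub>R\<^esub> (J +>\<^bsub>R\<^esub> a)"
    proof
      fix z assume "z \<in> I +>\<^bsub>R\<^esub> a"
      then obtain i where "i \<in> I" "z = i \<oplus>\<^bsub>R\<^esub> a" by (auto simp: a_r_coset_def')
      moreover have "z = i \<oplus>\<^bsub>R\<^esub> (\<zero>\<^bsub>R\<^esub> \<oplus>\<^bsub>R\<^esub> a)" using calculation assms by simp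
      ultimately show "z \<in> I <+>\<^bsub>R\<^esub> (J +>\<^bsub>R\<^esub> a)"
        using assms(3) unfolding set_add_def' a_r_coset_def' by blast
    qed
  qed
qed

section \<open>Detecting the leading term of an element\<close>

lemma exists_separating_functional:
  fixes scale :: "complex \<Rightarrow> 'v::ab_group_add \<Rightarrow> 'v"
  assumes "vector_space scale" "module.subspace scale W" "a \<notin> W"
  shows "\<exists>\<phi>. Vector_Spaces.linear scale (*) \<phi> \<and> (\<forall>w\<in>W. \<phi> w = 0) \<and> \<phi> a = 1"
proof -
  interpret V: vector_space scale by fact
  interpret C: vector_space "(*) :: complex \<Rightarrow> complex \<Rightarrow> complex"
    by unfold_locales (simp_all add: algebra_simps)
  interpret vector_space_pair scale "(*) :: complex \<Rightarrow> complex \<Rightarrow> complex" ..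
  obtain E where E: "E \<subseteq> W" "V.independent E" "W \<subseteq> V.span E"
    using V.maximal_independent_subset by blast
  have "V.span E \<subseteq> W" using V.span_minimal[OF E(1) assms(2)] .
  then have a: "a \<notin> V.span E" using assms(3) by blast
  then have "V.independent (insert a E)" using E(2) V.independent_insertI by blast
  then obtain \<phi> where \<phi>: "Vector_Spaces.linear scale (*) \<phi>"
      "\<forall>x\<in>insert a E. \<phi> x = (if x = a then 1 else 0)"
    using linear_independent_extend[of "insert a E" "\<lambda>x. if x = a then 1 else 0"] by blast
  have "\<phi> w = 0" if "w \<in> W" for w
  proof (rule linear_eq_0_on_span[OF \<phi>(1)])
    show "w \<in> V.span E" using that E by blast
    show "\<phi> x = 0" if "x \<in> E" for x
      using that a \<phi>(2) V.span_base[of a E] by auto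
  qed
  then show ?thesis using \<phi> by auto
qed

text \<open>The functions that arise as the degree \<open>D\<close> part of a linear functional killing the ideal of the
enveloping algebra and all words shorter than \<open>D\<close>: linear in every letter, and symmetric in degree
\<open>D\<close>, since exchanging two neighbours changes a word by a shorter one modulo the ideal.\<close>

definition symmetric_functional ::
  "(complex \<Rightarrow> 'l \<Rightarrow> 'l) \<Rightarrow> 'l::ab_group_add set \<Rightarrow> nat \<Rightarrow> ('l list \<Rightarrow> complex) \<Rightarrow> bool" where
  "symmetric_functional scale L D M \<longleftrightarrow>
     (\<forall>w\<in>lists L. length w < D \<longrightarrow> M w = 0) \<and>
     (\<forall>u\<in>lists L. \<forall>v\<in>lists L. \<forall>x\<in>L. \<forall>y\<in>L. M (u @ (x + y) # v) = M (u @ x # v) + M (u @ y # v)) \<and>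
     (\<forall>u\<in>lists L. \<forall>v\<in>lists L. \<forall>x\<in>L. \<forall>c. M (u @ scale c x # v) = c * M (u @ x # v)) \<and>
     (\<forall>u\<in>lists L. \<forall>v\<in>lists L. \<forall>x\<in>L. \<forall>y\<in>L. length (u @ x # y # v) = D \<longrightarrow>
        M (u @ x # y # v) = M (u @ y # x # v))"

context lie_subset
begin

text \<open>Among the representatives of \<open>Z\<close> take one, \<open>a\<close>, whose words have the smallest possible maximal
length.  As \<open>Z\<close> is not a scalar, this length is positive; write it as \<open>Suc d\<close>.  By minimality \<open>a\<close>
does not lie in the sum of the ideal and the span of the words of length at most \<open>d\<close>, and a linear
functional that separates \<open>a\<close> from this sum gives \<open>M\<close>.\<close>

lemma exists_leading_functional:
  assumes Z: "Z \<in> carrier (uea scale bracket L)"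
    and nonconst: "\<And>c. Z \<noteq> uea_scalar scale bracket L c"
  obtains a d M where "a \<in> carrier (free_algebra L)"
    and "Z = I +>\<^bsub>free_algebra L\<^esub> a"
    and "\<forall>w. a w \<noteq> 0 \<longrightarrow> length w \<le> Suc d"
    and "symmetric_functional scale L (Suc d) M"
    and "evaluate M a \<noteq> 0"
proof -
  let ?R = "free_algebra L"
  interpret ideal I ?R by (rule ideal_uea)
  let ?P = "\<lambda>n b. b \<in> carrier ?R \<and> I +>\<^bsub>?R\<^esub> b = Z \<and> (\<forall>w. b w \<noteq> 0 \<longrightarrow> length w \<le> n)"
  obtain a0 where a0: "a0 \<in> carrier ?R" "Z = I +>\<^bsub>?R\<^esub> a0"
    using Z by (auto simp: uea_def FactRing_def A_RCOSETS_def')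
  have "?P (Max (length ` {w. a0 w \<noteq> 0})) a0"
    using a0 by (auto simp: free_algebra_carrier)
  then have ex: "\<exists>n b. ?P n b" by blast
  define D where "D = (LEAST n. \<exists>b. ?P n b)"
  obtain a where a: "?P D a"
    using LeastI_ex[OF ex] unfolding D_def by blast
  have least: "\<not> ?P n b" if "n < D" for n b
    using not_less_Least[of n "\<lambda>n. \<exists>b. ?P n b"] that unfolding D_def by blast
  have "D \<noteq> 0"
  proof
    assume "D = 0"
    then have "a = free_scalar (a [])"
      using a by (auto simp: free_scalar_def fun_eq_iff)
    then have "Z = uea_scalar scale bracket L (a [])"
      using a unfolding uea_scalar_def by metis
    then show False using nonconst by blast
  qed
  then obtain d where D: "D = Suc d" using not0_implies_Suc by blast
  define W where "W = {(\<lambda>w. f w + g w) |f g. f \<in> I \<and> g \<in> carrier ?R \<and> (\<forall>w. g w \<noteq> 0 \<longrightarrow> length w \<le> d)}"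
  let ?scale = "\<lambda>c (f :: 'l list \<Rightarrow> complex) w. c * f w"
  interpret F: vector_space ?scale
    by unfold_locales (simp_all add: fun_eq_iff algebra_simps)
  have zero: "(\<lambda>w. 0) \<in> I" using zero_closed by simp
  have W_intro: "(\<lambda>w. f w + g w) \<in> W"
    if "f \<in> I" "g \<in> carrier ?R" "\<And>w. g w \<noteq> 0 \<Longrightarrow> length w \<le> d" for f g
    using that unfolding W_def by blast
  have "F.subspace W"
  proof (rule F.subspaceI)
    show "0 \<in> W"
      using W_intro[of "\<lambda>_. 0" "\<lambda>_. 0"] zero by (simp add: zero_fun_def free_algebra_carrier)
    fix x assume "x \<in> W"
    then obtain f g where fg: "x = (\<lambda>w. f w + g w)" "f \<in> I" "g \<in> carrier ?R"
      "\<And>w. g w \<noteq> 0 \<Longrightarrow> length w \<le> d" unfolding W_def by blast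
    have "(\<lambda>w. (c * f w + 0 * f w) + (c * g w + 0 * g w)) \<in> W" for c
      by (rule W_intro[OF uea_ideal_combination free_algebra_combination_closed]) (use fg in auto)
    then show "(\<lambda>w. c * x w) \<in> W" for c
      using fg(1) by (simp add: algebra_simps)
    fix y assume "y \<in> W"
    then obtain f' g' where fg': "y = (\<lambda>w. f' w + g' w)" "f' \<in> I" "g' \<in> carrier ?R"
      "\<And>w. g' w \<noteq> 0 \<Longrightarrow> length w \<le> d" unfolding W_def by blast
    have "(\<lambda>w. (1 * f w + 1 * f' w) + (1 * g w + 1 * g' w)) \<in> W"
    proof (rule W_intro[OF uea_ideal_combination free_algebra_combination_closed])
      fix w assume "1 * g w + 1 * g' w \<noteq> 0"
      then have "g w \<noteq> 0 \<or> g' w \<noteq> 0" by auto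
      then show "length w \<le> d" using fg(4) fg'(4) by blast
    qed (use fg fg' in auto)
    then show "x + y \<in> W"
      using fg(1) fg'(1) by (simp add: plus_fun_def algebra_simps)
  qed
  moreover have "a \<notin> W"
  proof
    assume "a \<in> W"
    then obtain f g where fg: "a = (\<lambda>w. f w + g w)" "f \<in> I" "g \<in> carrier ?R"
      "\<And>w. g w \<noteq> 0 \<Longrightarrow> length w \<le> d" unfolding W_def by blast
    have "a \<ominus>\<^bsub>?R\<^esub> g = f" using fg by (simp add: free_algebra_minus)
    then have "I +>\<^bsub>?R\<^esub> a = I +>\<^bsub>?R\<^esub> g"
      using free_algebra.quotient_eq_iff_same_a_r_cos[OF ideal_axioms, of a g] a fg by simp
    then show False using least[of d g] a fg D by auto
  qed
  ultimately obtain \<phi> where \<phi>: "Vector_Spaces.linear ?scale (*) \<phi>" "\<And>w. w \<in> W \<Longrightarrow> \<phi> w = 0" "\<phi> a = 1"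
    using exists_separating_functional[OF F.vector_space_axioms] by blast
  interpret \<phi>: Vector_Spaces.linear ?scale "(*)" \<phi> by fact
  have comb: "\<phi> (\<lambda>w. c * f w + e * g w) = c * \<phi> f + e * \<phi> g" for c e f g
    using \<phi>.add[of "\<lambda>w. c * f w" "\<lambda>w. e * g w"] \<phi>.scale[of c f] \<phi>.scale[of e g]
    by (simp add: plus_fun_def)
  have I0: "\<phi> f = 0" if "f \<in> I" for f
    using \<phi>(2)[OF W_intro[OF that, of "\<lambda>_. 0"]] by (simp add: free_algebra_carrier)
  define M where "M w = \<phi> (word w)" for w
  have low: "M w = 0" if "w \<in> lists L" "length w \<le> d" for w
  proof -
    have "(\<lambda>v. 0 + word w v) \<in> W"
      by (rule W_intro[OF zero word_closed[OF that(1)]])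
        (use that(2) in \<open>simp add: word_def split: if_splits\<close>)
    then show ?thesis using \<phi>(2) by (simp add: M_def)
  qed
  have eval: "\<phi> f = evaluate M f" if f: "finite {w. f w \<noteq> 0}" for f
  proof -
    have "\<phi> (\<lambda>v. \<Sum>w\<in>S. f w * word w v) = (\<Sum>w\<in>S. f w * M w)" if "finite S" for S
      using that
    proof induction
      case empty
      show ?case using \<phi>.zero by (simp add: zero_fun_def)
    next
      case (insert w S)
      then show ?case
        using comb[of "f w" "word w" 1 "\<lambda>v. \<Sum>w\<in>S. f w * word w v"] by (simp add: M_def)
    qed
    from this[OF f] have "\<phi> (\<lambda>v. if f v \<noteq> 0 then f v else 0) = evaluate M f"
      unfolding evaluate_def using f
      by (simp add: word_def if_distrib[of "(*) _"] cong: if_cong)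
    moreover have "(\<lambda>v. if f v \<noteq> 0 then f v else 0) = f" by auto
    ultimately show ?thesis by simp
  qed
  have "finite {w. a w \<noteq> 0}" using a by (simp add: free_algebra_carrier)
  with eval \<phi>(3) have nonzero: "evaluate M a \<noteq> 0" by simp
  have add: "M (u @ (x + y) # v) = M (u @ x # v) + M (u @ y # v)"
    if "u \<in> lists L" "v \<in> lists L" "x \<in> L" "y \<in> L" for u v x y
    using I0[OF sandwich_relations_in_ideal(1)[OF that]] by (simp only: comb M_def) (simp add: algebra_simps)
  have scale: "M (u @ scale c x # v) = c * M (u @ x # v)"
    if "u \<in> lists L" "v \<in> lists L" "x \<in> L" for u v c x
    using I0[OF sandwich_relations_in_ideal(2)[OF that]] by (simp only: comb M_def) simp
  have swap: "M (u @ x # y # v) = M (u @ y # x # v)"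
    if "u \<in> lists L" "v \<in> lists L" "x \<in> L" "y \<in> L" "length (u @ x # y # v) = Suc d" for u v x y
  proof -
    have "M (u @ bracket x y # v) = 0"
      using that bracket_closed by (intro low) auto
    then show ?thesis
      using I0[OF sandwich_relations_in_ideal(3)[OF that(1-4)]] by (simp only: comb M_def) simp
  qed
  have "symmetric_functional scale L (Suc d) M"
    unfolding symmetric_functional_def using low add scale swap by (simp add: less_Suc_eq_le)
  moreover have "a \<in> carrier ?R" "Z = I +>\<^bsub>?R\<^esub> a" "\<forall>w. a w \<noteq> 0 \<longrightarrow> length w \<le> Suc d"
    using a D by auto
  ultimately show ?thesis using nonzero by (intro that)
qed

end

text \<open>Polarisation.  Expanding every letter in the vectors \<open>e i\<close> with coordinates \<open>\<psi> i\<close>, and averaging over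
the orders of the letters, writes a symmetric multilinear function as a combination of products of
coordinate functionals.  The word \<open>u\<close> collects the letters that are already expanded, so that the
induction can proceed letter by letter.\<close>

lemma symmetric_functional_expansion:
  fixes M :: "'l list \<Rightarrow> complex" and \<psi> :: "'i \<Rightarrow> 'l \<Rightarrow> complex"
  assumes "finite J" and e: "\<And>i. i \<in> J \<Longrightarrow> e i \<in> L" and "A \<subseteq> L"
    and expand: "\<And>u v y. \<lbrakk>y \<in> A; u \<in> lists L; v \<in> lists L\<rbrakk> \<Longrightarrow>
      M (u @ y # v) = (\<Sum>i\<in>J. \<psi> i y * M (u @ e i # v))"
    and swap: "\<And>u v x y. \<lbrakk>u \<in> lists L; v \<in> lists L; x \<in> L; y \<in> L; length (u @ x # y # v) = D\<rbrakk> \<Longrightarrow>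
      M (u @ x # y # v) = M (u @ y # x # v)"
    and "u \<in> lists L" "w \<in> lists A" "length u + length w = D"
  shows "fact (length w) * M (u @ w) = (\<Sum>s\<in>{s. set s \<subseteq> J \<and> length s = length w}.
    convs (map (\<lambda>i. letter_functional (\<psi> i)) s) w * M (u @ map e s))"
  using assms(6-8)
proof (induction "length w" arbitrary: u w)
  case 0
  have "{s. set s \<subseteq> J \<and> length s = 0} = {[]}" by auto
  then show ?case using 0 by simp
next
  case (Suc n)
  define G where "G s = convs (map (\<lambda>i. letter_functional (\<psi> i)) s)" for s
  let ?S = "{s. set s \<subseteq> J \<and> length s = n}"
  have finS: "finite ?S" using finite_lists_length_eq[OF \<open>finite J\<close>] .
  \<comment> \<open>Symmetry under exchanging neighbours moves any letter to the front.\<close>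
  have to_front: "M (u @ p @ x # q) = M (u @ x # p @ q)"
    if "u \<in> lists L" "p \<in> lists L" "q \<in> lists L" "x \<in> L" "length u + length p + length q + 1 = D" for u p q x
    using that
  proof (induction p arbitrary: u)
    case (Cons y p)
    have "M (u @ (y # p) @ x # q) = M ((u @ [y]) @ x # p @ q)"
      using Cons.IH[of "u @ [y]"] Cons.prems by simp
    also have "\<dots> = M (u @ x # y # p @ q)"
      using swap[of u "p @ q" y x] Cons.prems by simp
    finally show ?case by simp
  qed simp
  let ?d = "\<lambda>j. take j w @ drop (Suc j) w"
  \<comment> \<open>The term in which the first factor of the product reads the \<open>j\<close>-th letter of \<open>w\<close>.\<close>
  have step: "(\<Sum>s\<in>?S. G s (?d j) * (\<Sum>i\<in>J. \<psi> i (w ! j) * M (u @ e i # map e s))) = fact n * M (u @ w)"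
    if j: "j < length w" for j
  proof -
    have jA: "w ! j \<in> A" "w ! j \<in> L" using j Suc.prems(2) \<open>A \<subseteq> L\<close> by auto
    have "w = take j w @ w ! j # drop (Suc j) w" by (rule id_take_nth_drop[OF j])
    then have "take j w @ w ! j # drop (Suc j) w \<in> lists A" using Suc.prems(2) by metis
    then have dA: "?d j \<in> lists A" "take j w \<in> lists A" "drop (Suc j) w \<in> lists A" by simp_all
    then have dL: "take j w \<in> lists L" "drop (Suc j) w \<in> lists L"
      using \<open>A \<subseteq> L\<close> by (meson lists_mono subsetD)+
    have "(\<Sum>s\<in>?S. G s (?d j) * (\<Sum>i\<in>J. \<psi> i (w ! j) * M (u @ e i # map e s))) =
        (\<Sum>s\<in>?S. G s (?d j) * M ((u @ [w ! j]) @ map e s))"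
    proof (intro sum.cong refl)
      fix s assume "s \<in> ?S"
      then have "map e s \<in> lists L" by (auto intro!: e)
      then show "G s (?d j) * (\<Sum>i\<in>J. \<psi> i (w ! j) * M (u @ e i # map e s)) =
          G s (?d j) * M ((u @ [w ! j]) @ map e s)"
        using expand[OF jA(1) Suc.prems(1), of "map e s"] by simp
    qed
    also have "\<dots> = fact n * M ((u @ [w ! j]) @ ?d j)"
    proof -
      have n: "length (?d j) = n" using j Suc.hyps(2) by simp
      have "fact (length (?d j)) * M ((u @ [w ! j]) @ ?d j) =
          (\<Sum>s\<in>{s. set s \<subseteq> J \<and> length s = length (?d j)}.
            convs (map (\<lambda>i. letter_functional (\<psi> i)) s) (?d j) * M ((u @ [w ! j]) @ map e s))"
      proof (rule Suc.hyps(1)[OF n[symmetric] _ dA(1)])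
        show "u @ [w ! j] \<in> lists L" using Suc.prems(1) jA by simp
        show "length (u @ [w ! j]) + length (?d j) = D" using Suc.prems(3) Suc.hyps(2) n by simp
      qed
      then show ?thesis by (simp only: n G_def)
    qed
    also have "M ((u @ [w ! j]) @ ?d j) = M (u @ take j w @ w ! j # drop (Suc j) w)"
      using to_front[OF Suc.prems(1) dL jA(2)] Suc.prems(3) j by simp
    also have "take j w @ w ! j # drop (Suc j) w = w"
      using id_take_nth_drop[OF j] by simp
    finally show ?thesis .
  qed
  have "(\<Sum>s\<in>{s. set s \<subseteq> J \<and> length s = Suc n}. G s w * M (u @ map e s)) =
      (\<Sum>(s, i)\<in>?S \<times> J. G (i # s) w * M (u @ e i # map e s))"
    unfolding lists_length_Suc_eq
    by (subst sum.reindex) (simp_all add: inj_on_def case_prod_unfold)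
  also have "\<dots> = (\<Sum>s\<in>?S. \<Sum>i\<in>J. G (i # s) w * M (u @ e i # map e s))"
    by (rule sum.cartesian_product[symmetric])
  also have "\<dots> = (\<Sum>s\<in>?S. \<Sum>i\<in>J. \<Sum>j<length w. \<psi> i (w ! j) * G s (?d j) * M (u @ e i # map e s))"
    by (simp add: G_def conv_letter_functional sum_distrib_right)
  also have "\<dots> = (\<Sum>s\<in>?S. \<Sum>j<length w. \<Sum>i\<in>J. \<psi> i (w ! j) * G s (?d j) * M (u @ e i # map e s))"
    by (intro sum.cong refl sum.swap)
  also have "\<dots> = (\<Sum>j<length w. \<Sum>s\<in>?S. \<Sum>i\<in>J. \<psi> i (w ! j) * G s (?d j) * M (u @ e i # map e s))"
    by (rule sum.swap)
  also have "\<dots> = (\<Sum>j<length w. fact n * M (u @ w))"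
  proof (rule sum.cong[OF refl])
    fix j assume "j \<in> {..<length w}"
    then have "fact n * M (u @ w) =
        (\<Sum>s\<in>?S. G s (?d j) * (\<Sum>i\<in>J. \<psi> i (w ! j) * M (u @ e i # map e s)))"
      using step by simp
    then show "(\<Sum>s\<in>?S. \<Sum>i\<in>J. \<psi> i (w ! j) * G s (?d j) * M (u @ e i # map e s)) = fact n * M (u @ w)"
      by (simp only: sum_distrib_left mult_ac)
  qed
  also have "\<dots> = fact (length w) * M (u @ w)"
    unfolding Suc.hyps(2)[symmetric] by (simp add: algebra_simps)
  finally show ?case using Suc.hyps(2) by (simp add: G_def)
qed

section \<open>Matrix coefficients of the toroidal algebra\<close>

context lie_algebra
begin

lemma bracket_add_right: "bracket x (y + z) = bracket x y + bracket x z"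
  and bracket_diff_right: "bracket x (y - z) = bracket x y - bracket x z"
  and bracket_scale_right: "bracket x (scale c y) = scale c (bracket x y)"
  and bracket_zero_right [simp]: "bracket x 0 = 0"
  and bracket_sum_right: "bracket x (sum h S) = (\<Sum>i\<in>S. bracket x (h i))"
proof -
  interpret Vector_Spaces.linear scale scale "bracket x" by (rule bracket_linear_right)
  show "bracket x (y + z) = bracket x y + bracket x z" "bracket x (y - z) = bracket x y - bracket x z"
    "bracket x (scale c y) = scale c (bracket x y)"
    "bracket x 0 = 0" "bracket x (sum h S) = (\<Sum>i\<in>S. bracket x (h i))"
    by (rule add diff scale zero sum)+
qed

lemma bracket_add_left: "bracket (x + y) z = bracket x z + bracket y z"
  and bracket_scale_left: "bracket (scale c x) z = scale c (bracket x z)"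
  and bracket_zero_left [simp]: "bracket 0 z = 0"
proof -
  interpret Vector_Spaces.linear scale scale "\<lambda>x. bracket x z" by (rule bracket_linear_left)
  show "bracket (x + y) z = bracket x z + bracket y z" "bracket (scale c x) z = scale c (bracket x z)"
    "bracket 0 z = 0"
    by (rule add scale zero)+
qed

lemma bracket_anticommute: "bracket y x = - bracket x y"
proof -
  have "0 = bracket (x + y) (x + y)" by (simp add: bracket_self)
  also have "\<dots> = bracket x y + bracket y x"
    by (simp only: bracket_add_left bracket_add_right) (simp add: bracket_self)
  finally show ?thesis by (metis add.commute minus_unique)
qed

text \<open>The Jacobi identity in the form that says that the adjoint map is a representation.\<close>

lemma bracket_bracket_left:
  "bracket (bracket x y) z = bracket x (bracket y z) - bracket y (bracket x z)"
proof -
  have "bracket y (bracket z x) = - bracket y (bracket x z)"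
    using bracket_diff_right[of y 0 "bracket x z"] by (simp add: bracket_anticommute[of z x])
  then show ?thesis
    using jacobi[of x y z] by (simp add: bracket_anticommute[of z "bracket x y"])
qed

text \<open>The toroidal algebra acts on all functions from exponents to \<open>\<gg>\<close>: the Laurent part by the bracket of
\<open>\<gg>\<close> and convolution of exponents, the derivations by the weight of the exponent, and the central
elements by zero.\<close>

definition laurent_action :: "(expo \<Rightarrow>\<^sub>0 'a) \<Rightarrow> (expo \<Rightarrow> 'a) \<Rightarrow> expo \<Rightarrow> 'a" where
  "laurent_action u f m = (\<Sum>n\<in>Poly_Mapping.keys u. bracket (Poly_Mapping.lookup u n) (f (m - n)))"

definition weight :: "(nat \<Rightarrow>\<^sub>0 complex) \<Rightarrow> expo \<Rightarrow> complex" where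
  "weight b m = (\<Sum>i\<in>Poly_Mapping.keys b. Poly_Mapping.lookup b i * of_int (Poly_Mapping.lookup m i))"

definition weight_action :: "(nat \<Rightarrow>\<^sub>0 complex) \<Rightarrow> (expo \<Rightarrow> 'a) \<Rightarrow> expo \<Rightarrow> 'a" where
  "weight_action b f m = scale (weight b m) (f m)"

definition tor_action :: "'a tor \<Rightarrow> (expo \<Rightarrow> 'a) \<Rightarrow> expo \<Rightarrow> 'a" where
  "tor_action X f m = laurent_action (fst X) f m + weight_action (snd (snd X)) f m"

lemma laurent_action_superset:
  assumes "finite S" "Poly_Mapping.keys u \<subseteq> S"
  shows "laurent_action u f m = (\<Sum>n\<in>S. bracket (Poly_Mapping.lookup u n) (f (m - n)))"
  unfolding laurent_action_def
  by (rule sum.mono_neutral_left) (use assms in \<open>auto simp: in_keys_iff\<close>)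

lemma laurent_action_add: "laurent_action (u + u') f m = laurent_action u f m + laurent_action u' f m"
proof -
  let ?S = "Poly_Mapping.keys u \<union> Poly_Mapping.keys u'"
  show ?thesis
    by (subst (1 2 3) laurent_action_superset[of ?S])
      (use Poly_Mapping.keys_add[of u u'] in \<open>auto simp: lookup_add bracket_add_left sum.distrib\<close>)
qed

lemma laurent_action_zero [simp]: "laurent_action 0 f m = 0"
  by (simp add: laurent_action_def)

lemma laurent_action_diff: "laurent_action (u - u') f m = laurent_action u f m - laurent_action u' f m"
  using laurent_action_add[of "u - u'" u' f m] by simp

lemma laurent_action_sum: "laurent_action (sum h S) f m = (\<Sum>i\<in>S. laurent_action (h i) f m)"
  by (induction S rule: infinite_finite_induct) (simp_all add: laurent_action_add)

lemma laurent_action_single: "laurent_action (Poly_Mapping.single n x) f m = bracket x (f (m - n))"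
  by (simp add: laurent_action_def)

lemma laurent_action_add_right:
  "laurent_action u (\<lambda>m. f m + g m) m = laurent_action u f m + laurent_action u g m"
  by (simp add: laurent_action_def bracket_add_right sum.distrib)

lemma laurent_action_scale:
  "laurent_action (Poly_Mapping.map (scale c) u) f m = scale c (laurent_action u f m)"
proof -
  have "Poly_Mapping.keys (Poly_Mapping.map (scale c) u) \<subseteq> Poly_Mapping.keys u"
    by (auto simp: in_keys_iff map.rep_eq when_def)
  then show ?thesis
    by (subst laurent_action_superset[of "Poly_Mapping.keys u"])
      (auto simp: laurent_action_def map.rep_eq when_def bracket_scale_left scale_sum_right in_keys_iff
        intro!: sum.cong)
qed

lemma laurent_action_commutator:
  "laurent_action u (laurent_action u' f) m - laurent_action u' (laurent_action u f) m =
   laurent_action (\<Sum>n\<in>Poly_Mapping.keys u. \<Sum>n'\<in>Poly_Mapping.keys u'.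
     Poly_Mapping.single (n + n') (bracket (Poly_Mapping.lookup u n) (Poly_Mapping.lookup u' n'))) f m"
proof -
  let ?u = "Poly_Mapping.lookup u" and ?u' = "Poly_Mapping.lookup u'"
  let ?K = "Poly_Mapping.keys u" and ?K' = "Poly_Mapping.keys u'"
  have "laurent_action u (laurent_action u' f) m =
      (\<Sum>n\<in>?K. \<Sum>n'\<in>?K'. bracket (?u n) (bracket (?u' n') (f (m - (n + n')))))"
    by (simp add: laurent_action_def bracket_sum_right diff_diff_eq)
  moreover have "laurent_action u' (laurent_action u f) m =
      (\<Sum>n\<in>?K. \<Sum>n'\<in>?K'. bracket (?u' n') (bracket (?u n) (f (m - (n + n')))))"
    by (subst sum.swap) (simp add: laurent_action_def bracket_sum_right diff_diff_eq add.commute)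
  ultimately show ?thesis
    by (simp add: laurent_action_sum laurent_action_single bracket_bracket_left sum_subtractf)
qed

lemma weight_diff: "weight b (m - n) = weight b m - weight b n"
  by (simp add: weight_def lookup_minus sum_subtractf algebra_simps)

lemma weight_add_left: "weight (b + b') m = weight b m + weight b' m"
proof -
  have sup: "weight c m = (\<Sum>i\<in>S. Poly_Mapping.lookup c i * of_int (Poly_Mapping.lookup m i))"
    if "finite S" "Poly_Mapping.keys c \<subseteq> S" for c S
    unfolding weight_def by (rule sum.mono_neutral_left) (use that in \<open>auto simp: in_keys_iff\<close>)
  let ?S = "Poly_Mapping.keys b \<union> Poly_Mapping.keys b'"
  show ?thesis
    by (subst (1 2 3) sup[of ?S])
      (use Poly_Mapping.keys_add[of b b'] in \<open>auto simp: lookup_add sum.distrib algebra_simps\<close>)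
qed

lemma weight_scale_left: "weight (Poly_Mapping.map ((*) c) b) m = c * weight b m"
proof -
  have "weight (Poly_Mapping.map ((*) c) b) m =
      (\<Sum>i\<in>Poly_Mapping.keys b. Poly_Mapping.lookup (Poly_Mapping.map ((*) c) b) i * of_int (Poly_Mapping.lookup m i))"
    unfolding weight_def
    by (rule sum.mono_neutral_left) (auto simp: in_keys_iff map.rep_eq when_def)
  then show ?thesis
    by (auto simp: weight_def map.rep_eq when_def sum_distrib_left in_keys_iff mult.assoc intro!: sum.cong)
qed

lemma weight_zero [simp]: "weight 0 m = 0"
  by (simp add: weight_def)

text \<open>The weight is additive in the exponent, so commuting the Laurent part past a derivation multiplies
each coefficient by the weight of its exponent.\<close>

lemma laurent_action_derivation:
  "laurent_action (tor_derivation scale b u) f m =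
     weight_action b (laurent_action u f) m - laurent_action u (weight_action b f) m"
proof -
  have "laurent_action (tor_derivation scale b u) f m =
    (\<Sum>n\<in>Poly_Mapping.keys u. scale (weight b n) (bracket (Poly_Mapping.lookup u n) (f (m - n))))"
    by (simp add: tor_derivation_def laurent_action_sum laurent_action_single bracket_scale_left
        flip: weight_def)
  also have "\<dots> = (\<Sum>n\<in>Poly_Mapping.keys u.
      scale (weight b m) (bracket (Poly_Mapping.lookup u n) (f (m - n))) -
      scale (weight b (m - n)) (bracket (Poly_Mapping.lookup u n) (f (m - n))))"
    by (simp add: weight_diff flip: scale_left_diff_distrib)
  also have "\<dots> = weight_action b (laurent_action u f) m - laurent_action u (weight_action b f) m"
    by (simp add: weight_action_def laurent_action_def bracket_scale_right sum_subtractf scale_sum_right)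
  finally show ?thesis .
qed

lemma tor_action_add: "tor_action (X + Y) f m = tor_action X f m + tor_action Y f m"
  by (simp add: tor_action_def laurent_action_add weight_action_def weight_add_left scale_left_distrib)

lemma tor_action_scale: "tor_action (tor_scale scale c X) f m = scale c (tor_action X f m)"
  by (cases X) (simp add: tor_action_def laurent_action_scale weight_action_def weight_scale_left
      scale_right_distrib)

lemma tor_action_add_right: "tor_action X (\<lambda>m. f m + g m) = (\<lambda>m. tor_action X f m + tor_action X g m)"
  by (simp add: tor_action_def laurent_action_def weight_action_def bracket_add_right sum.distrib
      scale_right_distrib fun_eq_iff)

lemma tor_action_scale_right: "tor_action X (\<lambda>m. scale c (f m)) = (\<lambda>m. scale c (tor_action X f m))"
  by (simp add: tor_action_def laurent_action_def weight_action_def bracket_scale_right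
      scale_right_distrib scale_sum_right scale_left_commute fun_eq_iff)

text \<open>The Laurent parts contribute the representation property of the bracket of \<open>\<gg>\<close>, the mixed terms are
the derivation terms of the bracket, and weights commute with each other.\<close>

lemma tor_action_bracket:
  "tor_action (tor_bracket scale bracket B X Y) f m =
     tor_action X (tor_action Y f) m - tor_action Y (tor_action X f) m"
proof -
  obtain u a b u' a' b' where XY: "X = (u, a, b)" "Y = (u', a', b')" by (cases X, cases Y)
  have eq: "tor_action (u, a, b) f = (\<lambda>m. laurent_action u f m + weight_action b f m)"
    for u a b f by (simp add: tor_action_def fun_eq_iff)
  have comm: "weight_action b (weight_action b' f) m = weight_action b' (weight_action b f) m"
    by (simp add: weight_action_def mult.commute)
  have add: "weight_action b (\<lambda>m. f m + g m) m = weight_action b f m + weight_action b g m" for b f g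
    by (simp add: weight_action_def scale_right_distrib)
  show ?thesis
    unfolding XY tor_bracket.simps eq
    by (simp add: laurent_action_add laurent_action_diff laurent_action_derivation
        laurent_action_commutator[symmetric] laurent_action_add_right comm add)
      (simp add: weight_action_def)
qed

text \<open>The vector is \<open>z\<close> placed at the exponent \<open>0\<close>, and the covector is \<open>\<eta>\<close> read at the exponent \<open>n\<close>.  For
\<open>n \<noteq> 0\<close> the empty word has value zero, as is needed of the factors of a product.\<close>

definition matrix_coefficient :: "('a \<Rightarrow> complex) \<Rightarrow> expo \<Rightarrow> 'a \<Rightarrow> 'a tor list \<Rightarrow> complex" where
  "matrix_coefficient \<eta> n z w = \<eta> (foldr tor_action w (\<lambda>m. if m = 0 then z else 0) n)"

lemma foldr_tor_action_add:
  "foldr tor_action w (\<lambda>m. f m + g m) = (\<lambda>m. foldr tor_action w f m + foldr tor_action w g m)"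
  and foldr_tor_action_scale:
  "foldr tor_action w (\<lambda>m. scale c (f m)) = (\<lambda>m. scale c (foldr tor_action w f m))"
  by (induction w) (simp_all add: tor_action_add_right tor_action_scale_right)

lemma enveloping_functional_matrix_coefficient:
  assumes "Vector_Spaces.linear scale (*) \<eta>"
  shows "enveloping_functional (tor_scale scale) (tor_bracket scale bracket B) (matrix_coefficient \<eta> n z)"
proof -
  interpret \<eta>: Vector_Spaces.linear scale "(*)" \<eta> by fact
  have bracket: "tor_action X (tor_action Y f) =
    (\<lambda>m. tor_action Y (tor_action X f) m + tor_action (tor_bracket scale bracket B X Y) f m)" for X Y f
    by (simp add: tor_action_bracket fun_eq_iff)
  have add: "tor_action (X + Y) f = (\<lambda>m. tor_action X f m + tor_action Y f m)" for X Y f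
    by (simp add: tor_action_add fun_eq_iff)
  have scale: "tor_action (tor_scale scale c X) f = (\<lambda>m. scale c (tor_action X f m))" for c X f
    by (simp add: tor_action_scale fun_eq_iff)
  show ?thesis
    unfolding enveloping_functional_def
  proof (intro conjI allI)
    fix u v X Y
    show "matrix_coefficient \<eta> n z (u @ X # Y # v) - matrix_coefficient \<eta> n z (u @ Y # X # v) =
       matrix_coefficient \<eta> n z (u @ tor_bracket scale bracket B X Y # v)"
      by (simp add: matrix_coefficient_def bracket[of X Y] foldr_tor_action_add \<eta>.add)
  qed (simp_all add: matrix_coefficient_def add scale foldr_tor_action_add foldr_tor_action_scale
      \<eta>.add \<eta>.scale)
qed

lemma matrix_coefficient_Nil:
  assumes "Vector_Spaces.linear scale (*) \<eta>" "n \<noteq> 0"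
  shows "matrix_coefficient \<eta> n z [] = 0"
proof -
  interpret \<eta>: Vector_Spaces.linear scale "(*)" \<eta> by fact
  show ?thesis using assms(2) by (simp add: matrix_coefficient_def \<eta>.zero)
qed

lemma matrix_coefficient_letter:
  assumes "n \<noteq> 0"
  shows "matrix_coefficient \<eta> n z [y] = \<eta> (bracket (Poly_Mapping.lookup (fst y) n) z)"
proof -
  have "laurent_action u (\<lambda>m. if m = 0 then z else 0) n = bracket (Poly_Mapping.lookup u n) z" for u
  proof -
    have "laurent_action u (\<lambda>m. if m = 0 then z else 0) n =
        (\<Sum>m\<in>insert n (Poly_Mapping.keys u). bracket (Poly_Mapping.lookup u m) (if n - m = 0 then z else 0))"
      by (rule laurent_action_superset) auto
    also have "\<dots> = (\<Sum>m\<in>{n}. bracket (Poly_Mapping.lookup u m) (if n - m = 0 then z else 0))"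
      by (rule sum.mono_neutral_right) auto
    finally show ?thesis by simp
  qed
  then show ?thesis
    using assms by (simp add: matrix_coefficient_def tor_action_def weight_action_def)
qed

text \<open>Only the derivation part of \<open>y\<close> could act on the monomial itself, hence the assumption on \<open>y\<close>.\<close>

lemma lookup_bracket_monom:
  assumes "snd (snd y) = 0"
  shows "Poly_Mapping.lookup (fst (tor_bracket scale bracket B (tor_monom x e) y)) n =
    bracket x (Poly_Mapping.lookup (fst y) (n - e))"
proof -
  obtain u a where y: "y = (u, a, 0)" using assms by (cases y) auto
  have d: "tor_derivation scale 0 u' = 0" for u'
    by (simp add: tor_derivation_def)
  have "fst (tor_bracket scale bracket B (tor_monom x e) y) =
    (\<Sum>m\<in>Poly_Mapping.keys u. Poly_Mapping.single (e + m) (bracket x (Poly_Mapping.lookup u m)))"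
    by (cases "x = 0") (simp_all add: y tor_monom_def d)
  then have "Poly_Mapping.lookup (fst (tor_bracket scale bracket B (tor_monom x e) y)) n =
    (\<Sum>m\<in>Poly_Mapping.keys u. if m = n - e then bracket x (Poly_Mapping.lookup u m) else 0)"
    by (simp add: lookup_sum lookup_single when_def eq_diff_eq add.commute)
  also have "\<dots> = bracket x (Poly_Mapping.lookup u (n - e))"
    by (simp add: in_keys_iff)
  finally show ?thesis by (simp add: y)
qed

text \<open>The commutator with \<open>x \<otimes> t\<^sup>e\<close> raises the exponents of the letter by \<open>e\<close> before the coefficient at \<open>n\<close>
is read.\<close>

lemma ad_matrix_coefficient_letter:
  assumes "Vector_Spaces.linear scale (*) \<eta>" "n \<noteq> 0" "snd (snd y) = 0"
  shows "ad_functional (tor_monom x e) (matrix_coefficient \<eta> n z) [y] =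
    \<eta> (bracket (bracket x (Poly_Mapping.lookup (fst y) (n - e))) z)"
proof -
  let ?f = "matrix_coefficient \<eta> n z" and ?X = "tor_monom x e"
  have "ad_functional ?X ?f [y] = ?f [tor_bracket scale bracket (\<lambda>_ _. 0) ?X y]"
    using enveloping_functionalD(3)[OF enveloping_functional_matrix_coefficient[OF assms(1)], of n z "[]" ?X y "[]"]
    by (simp add: ad_functional_def)
  then show ?thesis using assms by (simp add: matrix_coefficient_letter lookup_bracket_monom)
qed

end

section \<open>Closure properties of the toroidal subalgebras\<close>

lemma keys_map_subset: "Poly_Mapping.keys u \<subseteq> N \<Longrightarrow> Poly_Mapping.keys (Poly_Mapping.map f u) \<subseteq> N"
  by (auto simp: subset_iff in_keys_iff map.rep_eq when_def split: if_splits)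

lemma map_zero [simp]: "Poly_Mapping.map f 0 = 0"
  by (rule poly_mapping_eqI) (simp add: map.rep_eq)

lemma keys_add_subset:
  "\<lbrakk>Poly_Mapping.keys u \<subseteq> N; Poly_Mapping.keys v \<subseteq> N\<rbrakk> \<Longrightarrow> Poly_Mapping.keys (u + v) \<subseteq> N"
  using Poly_Mapping.keys_add[of u v] by blast

lemma keys_diff_subset:
  fixes u v :: "'b \<Rightarrow>\<^sub>0 'c::ab_group_add"
  shows "\<lbrakk>Poly_Mapping.keys u \<subseteq> N; Poly_Mapping.keys v \<subseteq> N\<rbrakk> \<Longrightarrow> Poly_Mapping.keys (u - v) \<subseteq> N"
  using keys_diff[of u v] by blast

lemma keys_sum_subset:
  "(\<And>i. i \<in> S \<Longrightarrow> Poly_Mapping.keys (h i) \<subseteq> N) \<Longrightarrow> Poly_Mapping.keys (sum h S) \<subseteq> N"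
  by (induction S rule: infinite_finite_induct) (simp_all add: keys_add_subset)

lemma keys_single_subset: "n \<in> N \<Longrightarrow> Poly_Mapping.keys (Poly_Mapping.single n x) \<subseteq> N"
  by simp

text \<open>The derivation terms do not move exponents; the remaining ones add them.\<close>

lemma keys_tor_bracket_subset:
  assumes "Poly_Mapping.keys (fst X) \<subseteq> N" "Poly_Mapping.keys (fst Y) \<subseteq> N"
    and "\<And>n m. \<lbrakk>n \<in> N; m \<in> N\<rbrakk> \<Longrightarrow> n + m \<in> N"
  shows "Poly_Mapping.keys (fst (tor_bracket scale bracket B X Y)) \<subseteq> N"
proof -
  obtain u a b u' a' b' where XY: "X = (u, a, b)" "Y = (u', a', b')" by (cases X, cases Y)
  have *: "Poly_Mapping.keys u \<subseteq> N" "Poly_Mapping.keys u' \<subseteq> N" using assms XY by auto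
  show ?thesis
    unfolding XY tor_bracket.simps fst_conv tor_derivation_def
    by (intro keys_diff_subset keys_add_subset keys_sum_subset keys_single_subset assms(3);
        use * in blast)
qed

lemma toroidal_iff:
  "X \<in> toroidal k \<longleftrightarrow> Poly_Mapping.keys (fst X) \<subseteq> {n. Poly_Mapping.keys n \<subseteq> {1..k}} \<and>
     Poly_Mapping.keys (fst (snd X)) \<subseteq> {1..k} \<and> Poly_Mapping.keys (snd (snd X)) \<subseteq> {1..k}"
  by (cases X) (auto simp: toroidal_def)

lemma toroidal_minus_iff:
  "X \<in> toroidal_minus k \<longleftrightarrow>
     Poly_Mapping.keys (fst X) \<subseteq> {n. Poly_Mapping.keys n \<subseteq> {1..k} \<and> Poly_Mapping.lookup n k \<le> -1} \<and>
     snd X = 0"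
  by (cases X) (auto simp: toroidal_minus_def zero_prod_def)

lemma fst_tor_scale: "fst (tor_scale scale c X) = Poly_Mapping.map (scale c) (fst X)"
  and snd_tor_scale: "snd (tor_scale scale c X) =
    (Poly_Mapping.map ((*) c) (fst (snd X)), Poly_Mapping.map ((*) c) (snd (snd X)))"
  by (cases X, simp)+

lemma lie_subset_toroidal: "lie_subset (tor_scale scale) (tor_bracket scale bracket B) (toroidal k)"
proof
  fix X Y :: "'a tor" and c
  assume X: "X \<in> toroidal k"
  then show "tor_scale scale c X \<in> toroidal k"
    unfolding toroidal_iff fst_tor_scale snd_tor_scale fst_conv snd_conv by (simp only: keys_map_subset)
  assume Y: "Y \<in> toroidal k"
  show "X + Y \<in> toroidal k"
    using X Y unfolding toroidal_iff fst_add snd_add by (simp only: keys_add_subset)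
  obtain u a b u' a' b' where XY: "X = (u, a, b)" "Y = (u', a', b')" by (cases X, cases Y)
  have "Poly_Mapping.keys (fst (tor_bracket scale bracket B X Y)) \<subseteq> {n. Poly_Mapping.keys n \<subseteq> {1..k}}"
  proof (rule keys_tor_bracket_subset)
    fix n m :: expo assume "n \<in> {n. Poly_Mapping.keys n \<subseteq> {1..k}}" "m \<in> {n. Poly_Mapping.keys n \<subseteq> {1..k}}"
    then show "n + m \<in> {n. Poly_Mapping.keys n \<subseteq> {1..k}}" by (simp only: mem_Collect_eq keys_add_subset)
  qed (use X Y in \<open>simp_all only: toroidal_iff\<close>)
  moreover have "Poly_Mapping.keys (fst (snd (tor_bracket scale bracket B X Y))) \<subseteq> {1..k}"
    unfolding XY tor_bracket.simps fst_conv snd_conv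
  proof (intro keys_sum_subset)
    fix n m assume "n \<in> Poly_Mapping.keys u"
    then have "Poly_Mapping.keys n \<subseteq> {1..k}" using X by (auto simp: toroidal_iff XY)
    then show "Poly_Mapping.keys (if n + m = 0 then Poly_Mapping.map (\<lambda>j. B (Poly_Mapping.lookup u n)
        (Poly_Mapping.lookup u' m) * of_int j) n else 0) \<subseteq> {1..k}"
      by (simp add: keys_map_subset)
  qed
  moreover have "snd (snd (tor_bracket scale bracket B X Y)) = 0" by (simp add: XY)
  ultimately show "tor_bracket scale bracket B X Y \<in> toroidal k"
    by (simp add: toroidal_iff)
qed

lemma lie_subset_toroidal_minus:
  assumes "lie_algebra scale bracket"
  shows "lie_subset (tor_scale scale) (tor_bracket scale bracket B) (toroidal_minus k)"
proof
  interpret lie_algebra scale bracket by fact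
  let ?N = "{n :: expo. Poly_Mapping.keys n \<subseteq> {1..k} \<and> Poly_Mapping.lookup n k \<le> -1}"
  fix X Y :: "'a tor" and c
  assume X: "X \<in> toroidal_minus k"
  then show "tor_scale scale c X \<in> toroidal_minus k"
    unfolding toroidal_minus_iff fst_tor_scale snd_tor_scale
    by (simp only: keys_map_subset) (simp add: zero_prod_def)
  assume Y: "Y \<in> toroidal_minus k"
  show "X + Y \<in> toroidal_minus k"
    using X Y keys_add_subset[of "fst X" ?N "fst Y"] unfolding toroidal_minus_iff by simp
  obtain u u' where XY: "X = (u, 0, 0)" "Y = (u', 0, 0)"
    using X Y by (cases X, cases Y) (auto simp: toroidal_minus_iff zero_prod_def)
  have "Poly_Mapping.keys (fst (tor_bracket scale bracket B X Y)) \<subseteq> ?N"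
  proof (rule keys_tor_bracket_subset)
    fix n m assume "n \<in> ?N" "m \<in> ?N"
    then show "n + m \<in> ?N" using keys_add_subset[of n "{1..k}" m] by (simp add: lookup_add)
  qed (use X Y in \<open>auto simp: toroidal_minus_iff\<close>)
  \<comment> \<open>Both exponents of the last variable are negative, so the cocycle is never reached.\<close>
  moreover have "snd (tor_bracket scale bracket B X Y) = 0"
  proof -
    have "n + m \<noteq> 0" if "n \<in> Poly_Mapping.keys u" "m \<in> Poly_Mapping.keys u'" for n m
    proof
      assume "n + m = 0"
      then have "Poly_Mapping.lookup n k + Poly_Mapping.lookup m k = 0"
        by (metis lookup_add lookup_zero)
      moreover have "Poly_Mapping.lookup n k \<le> -1" "Poly_Mapping.lookup m k \<le> -1"
        using X Y that by (auto simp: toroidal_minus_iff XY)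
      ultimately show False by linarith
    qed
    then show ?thesis by (simp add: XY zero_prod_def)
  qed
  ultimately show "tor_bracket scale bracket B X Y \<in> toroidal_minus k"
    by (simp add: toroidal_minus_iff)
qed

lemma toroidal_minus_subset: "toroidal_minus k \<subseteq> toroidal k"
  by (auto simp: toroidal_def toroidal_minus_def)

section \<open>Dependence of a product on one factor\<close>

text \<open>The combinations of evaluations at finitely many points.  Multilinear expressions in several linear
forms are of this kind in each form separately, and applying one to forms on a vector space amounts
to evaluating them at a single vector.\<close>

definition evaluation_combination :: "(('l \<Rightarrow> complex) \<Rightarrow> complex) \<Rightarrow> bool" where
  "evaluation_combination \<Phi> \<longleftrightarrow> (\<exists>cs. \<forall>\<psi>. \<Phi> \<psi> = (\<Sum>(c, x)\<leftarrow>cs. c * \<psi> x))"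

lemma evaluation_combination_zero: "evaluation_combination (\<lambda>\<psi>. 0)"
  unfolding evaluation_combination_def by (rule exI[of _ "[]"]) simp

lemma evaluation_combination_point: "evaluation_combination (\<lambda>\<psi>. \<psi> x)"
  unfolding evaluation_combination_def by (rule exI[of _ "[(1, x)]"]) simp

lemma evaluation_combination_add:
  assumes "evaluation_combination \<Phi>" "evaluation_combination \<Psi>"
  shows "evaluation_combination (\<lambda>\<psi>. \<Phi> \<psi> + \<Psi> \<psi>)"
proof -
  obtain cs ds where "\<forall>\<psi>. \<Phi> \<psi> = (\<Sum>(c, x)\<leftarrow>cs. c * \<psi> x)" "\<forall>\<psi>. \<Psi> \<psi> = (\<Sum>(c, x)\<leftarrow>ds. c * \<psi> x)"
    using assms unfolding evaluation_combination_def by blast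
  then show ?thesis
    unfolding evaluation_combination_def by (intro exI[of _ "cs @ ds"]) simp
qed

lemma evaluation_combination_scale:
  assumes "evaluation_combination \<Phi>"
  shows "evaluation_combination (\<lambda>\<psi>. a * \<Phi> \<psi>)"
proof -
  obtain cs where cs: "\<forall>\<psi>. \<Phi> \<psi> = (\<Sum>(c, x)\<leftarrow>cs. c * \<psi> x)"
    using assms unfolding evaluation_combination_def by blast
  have "a * (\<Sum>(c, x)\<leftarrow>cs. c * \<psi> x) = (\<Sum>(c, x)\<leftarrow>map (\<lambda>(c, x). (a * c, x)) cs. c * \<psi> x)" for \<psi>
    by (induction cs) (auto simp: algebra_simps)
  with cs show ?thesis unfolding evaluation_combination_def by metis
qed

lemma evaluation_combination_conv_left:
  assumes "\<And>w. evaluation_combination (\<lambda>\<psi>. h \<psi> w)"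
  shows "evaluation_combination (\<lambda>\<psi>. conv (h \<psi>) g w)"
  using assms
proof (induction w arbitrary: h g)
  case Nil
  show ?case
    using evaluation_combination_scale[OF Nil, of "g []" "[]"] by (simp add: mult.commute)
next
  case (Cons x w)
  show ?case
    unfolding conv_Cons
    by (intro evaluation_combination_add Cons.IH[of "\<lambda>\<psi> u. h \<psi> (x # u)"] Cons.IH Cons.prems)
qed

lemma evaluation_combination_conv_right:
  assumes "\<And>w. evaluation_combination (\<lambda>\<psi>. h \<psi> w)"
  shows "evaluation_combination (\<lambda>\<psi>. conv g (h \<psi>) w)"
  using assms
proof (induction w arbitrary: h g)
  case Nil
  show ?case
    using evaluation_combination_scale[OF Nil, of "g []" "[]"] by simp
next
  case (Cons x w)
  show ?case
    unfolding conv_Cons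
    by (intro evaluation_combination_add Cons.IH[of "\<lambda>\<psi> u. h \<psi> (x # u)"] Cons.IH Cons.prems)
qed

lemma evaluation_combination_convs:
  "evaluation_combination (\<lambda>\<psi>. convs (qs @ letter_functional \<psi> # ps) w)"
proof (induction qs arbitrary: w)
  case Nil
  have "evaluation_combination (\<lambda>\<psi>. letter_functional \<psi> u)" for u
    by (cases u rule: remdups_adj.cases)
      (simp_all add: evaluation_combination_zero evaluation_combination_point)
  from evaluation_combination_conv_left[of letter_functional, OF this] show ?case by simp
next
  case (Cons f qs)
  from evaluation_combination_conv_right[of "\<lambda>\<psi>. convs (qs @ letter_functional \<psi> # ps)", OF Cons]
  show ?case by simp
qed

lemma evaluation_combination_evaluate:
  assumes "\<And>w. evaluation_combination (\<lambda>\<psi>. h \<psi> w)"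
  shows "evaluation_combination (\<lambda>\<psi>. evaluate (h \<psi>) a)"
proof -
  have "evaluation_combination (\<lambda>\<psi>. \<Sum>w\<in>S. a w * h \<psi> w)" for S
    by (induction S rule: infinite_finite_induct)
      (simp_all add: evaluation_combination_zero evaluation_combination_add
        evaluation_combination_scale assms)
  then show ?thesis unfolding evaluate_def .
qed

section \<open>Replacing coordinates by matrix coefficients\<close>

context lie_algebra
begin

lemma exists_linear_functional_nonzero:
  assumes "v \<noteq> 0"
  shows "\<exists>\<eta>. Vector_Spaces.linear scale (*) \<eta> \<and> \<eta> v \<noteq> 0"
  using exists_separating_functional[OF vector_space_axioms, of "{0}" v] assms
  by (auto simp: subspace_def)

lemma linear_functional_bracket_right:
  assumes "Vector_Spaces.linear scale (*) \<eta>"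
  shows "Vector_Spaces.linear scale (*) (\<lambda>y. \<eta> (bracket y z))"
  using Vector_Spaces.linear_compose[OF bracket_linear_left assms] by (simp add: o_def)

text \<open>The factors from which the products of coordinate functionals are built; for fixed \<open>n\<close> they depend
linearly on \<open>\<beta>\<close>, so that \<open>\<beta>\<close> can be exchanged for a form that suits the representation.\<close>

definition slot :: "expo \<Rightarrow> ('a \<Rightarrow> complex) \<Rightarrow> 'a tor list \<Rightarrow> complex" where
  "slot n \<beta> = letter_functional (\<lambda>X. \<beta> (Poly_Mapping.lookup (fst X) n))"

text \<open>With the other factors fixed, the value of a product on \<open>a\<close> is a combination of evaluations of \<open>\<beta>\<close> at
coefficients of letters, hence the value of \<open>\<beta>\<close> at the corresponding combination \<open>y\<close> of these
coefficients.\<close>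

lemma slot_represented:
  "\<exists>y. \<forall>\<beta>. Vector_Spaces.linear scale (*) \<beta> \<longrightarrow> evaluate (convs (qs @ slot n \<beta> # ps)) a = \<beta> y"
proof -
  have "evaluation_combination (\<lambda>\<psi>. evaluate (convs (qs @ letter_functional \<psi> # ps)) a)"
    by (intro evaluation_combination_evaluate evaluation_combination_convs)
  then obtain cs where cs:
    "\<And>\<psi>. evaluate (convs (qs @ letter_functional \<psi> # ps)) a = (\<Sum>(c, x)\<leftarrow>cs. c * \<psi> x)"
    unfolding evaluation_combination_def by blast
  let ?y = "\<Sum>(c, X)\<leftarrow>cs. scale c (Poly_Mapping.lookup (fst X) n)"
  have "(\<Sum>(c, X)\<leftarrow>cs. c * \<beta> (Poly_Mapping.lookup (fst X) n)) = \<beta> ?y"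
    if "Vector_Spaces.linear scale (*) \<beta>" for \<beta>
  proof -
    interpret \<beta>: Vector_Spaces.linear scale "(*)" \<beta> by fact
    show ?thesis by (induction cs) (auto simp: \<beta>.zero \<beta>.add \<beta>.scale)
  qed
  then show ?thesis unfolding slot_def cs by blast
qed

end

context simple_lie_algebra
begin

text \<open>The centre is an ideal, and it is not everything because the algebra is not abelian.\<close>

lemma center_trivial:
  assumes "y \<noteq> 0"
  shows "\<exists>x. bracket x y \<noteq> 0"
proof -
  let ?C = "{y. \<forall>x. bracket x y = 0}"
  have "lie_ideal ?C"
    by (auto simp: lie_ideal_def subspace_def bracket_add_right bracket_scale_right)
  then have "?C = {0} \<or> ?C = UNIV" by (rule ideal_trivial)
  moreover have "?C \<noteq> UNIV" using non_abelian by auto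
  ultimately have "?C = {0}" by blast
  then show ?thesis using assms by auto
qed

lemma exists_bracket_functional:
  assumes "y \<noteq> 0"
  shows "\<exists>\<eta> z. Vector_Spaces.linear scale (*) \<eta> \<and> \<eta> (bracket y z) \<noteq> 0"
proof -
  obtain z where "bracket z y \<noteq> 0" using center_trivial[OF assms] by blast
  then have "bracket y z \<noteq> 0" using bracket_anticommute[of y z] by auto
  then show ?thesis using exists_linear_functional_nonzero by blast
qed

text \<open>The factors are exchanged from left to right, \<open>qs\<close> being those already treated.  The value as a
function of the next form \<open>\<beta>\<close> is \<open>\<beta> y\<close> with \<open>y \<noteq> 0\<close>, and as the centre is trivial some form
\<open>y \<mapsto> \<eta> [y, z]\<close> does not vanish at \<open>y\<close> either.\<close>

lemma slots_realizable:
  assumes "\<And>\<beta> n. (\<beta>, n) \<in> set ps \<Longrightarrow> Vector_Spaces.linear scale (*) \<beta>"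
    and "evaluate (convs (qs @ map (\<lambda>(\<beta>, n). slot n \<beta>) ps)) a \<noteq> 0"
  shows "\<exists>ts. map (\<lambda>(\<eta>, z, n). n) ts = map snd ps \<and>
    (\<forall>t\<in>set ts. Vector_Spaces.linear scale (*) (fst t)) \<and>
    evaluate (convs (qs @ map (\<lambda>(\<eta>, z, n). slot n (\<lambda>y. \<eta> (bracket y z))) ts)) a \<noteq> 0"
  using assms
proof (induction ps arbitrary: qs)
  case Nil
  then show ?case by (intro exI[of _ "[]"]) simp
next
  case (Cons p ps)
  obtain \<beta> n where p: "p = (\<beta>, n)" by (cases p)
  let ?rest = "map (\<lambda>(\<beta>, n). slot n \<beta>) ps"
  obtain y where y: "\<And>\<beta>. Vector_Spaces.linear scale (*) \<beta> \<Longrightarrow>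
      evaluate (convs (qs @ slot n \<beta> # ?rest)) a = \<beta> y"
    using slot_represented by blast
  have \<beta>: "Vector_Spaces.linear scale (*) \<beta>" using Cons.prems(1) p by auto
  have "\<beta> y \<noteq> 0" using Cons.prems(2) y[OF \<beta>] p by simp
  moreover have "\<beta> 0 = 0"
  proof -
    interpret \<beta>: Vector_Spaces.linear scale "(*)" \<beta> by (rule \<beta>)
    show ?thesis by (rule \<beta>.zero)
  qed
  ultimately obtain \<eta> z where \<eta>: "Vector_Spaces.linear scale (*) \<eta>" "\<eta> (bracket y z) \<noteq> 0"
    using exists_bracket_functional by metis
  let ?s = "slot n (\<lambda>y. \<eta> (bracket y z))"
  have "evaluate (convs ((qs @ [?s]) @ ?rest)) a \<noteq> 0"
    using y[OF linear_functional_bracket_right[OF \<eta>(1)]] \<eta>(2) by simp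
  moreover have "Vector_Spaces.linear scale (*) \<beta>" if "(\<beta>, n) \<in> set ps" for \<beta> n
    using Cons.prems(1) that by auto
  ultimately obtain ts where
    "map (\<lambda>(\<eta>, z, n). n) ts = map snd ps" "\<forall>t\<in>set ts. Vector_Spaces.linear scale (*) (fst t)"
    "evaluate (convs ((qs @ [?s]) @ map (\<lambda>(\<eta>, z, n). slot n (\<lambda>y. \<eta> (bracket y z))) ts)) a \<noteq> 0"
    using Cons.IH[of "qs @ [?s]"] by blast
  then show ?case using \<eta>(1) p by (intro exI[of _ "(\<eta>, z, n) # ts"]) simp
qed

lemma finite_coordinates:
  "\<exists>E \<beta>. finite E \<and> (\<forall>b\<in>E. Vector_Spaces.linear scale (*) (\<beta> b)) \<and> (\<forall>v. v = (\<Sum>b\<in>E. scale (\<beta> b v) b))"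
proof -
  obtain S where S: "finite S" "span S = UNIV" using finite_dimensional by blast
  obtain E where E: "E \<subseteq> S" "independent E" "S \<subseteq> span E"
    using maximal_independent_subset by blast
  have span: "span E = UNIV" using S(2) E(3) span_mono[of S "span E"] by (auto simp: span_span)
  have fin: "finite E" using S(1) E(1) finite_subset by blast
  have "Vector_Spaces.linear scale (*) (\<lambda>v. representation E v b)" for b
    unfolding Vector_Spaces.linear_iff
    using vector_space_axioms E(2) span
    by (auto simp: representation_add representation_scale vector_space_def algebra_simps)
  moreover have "v = (\<Sum>b\<in>E. scale (representation E v b) b)" for v
    using sum_representation_eq[OF E(2), of v E] fin span by simp
  ultimately show ?thesis
    using fin by (intro exI[of _ E] exI[of _ "\<lambda>b v. representation E v b"] conjI ballI allI)
qed

end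

section \<open>Commutators with large shifts\<close>

context simple_lie_algebra
begin

definition exponents :: "('a tor list \<Rightarrow> complex) \<Rightarrow> expo set" where
  "exponents a = (\<Union>w\<in>{w. a w \<noteq> 0}. \<Union>X\<in>set w. Poly_Mapping.keys (fst X))"

lemma exponents_toroidal_minus:
  assumes "a \<in> carrier (free_algebra (toroidal_minus k))" "n \<in> exponents a"
  shows "Poly_Mapping.keys n \<subseteq> {1..k} \<and> Poly_Mapping.lookup n k \<le> -1"
proof -
  obtain w X where "a w \<noteq> 0" "X \<in> set w" and n: "n \<in> Poly_Mapping.keys (fst X)"
    using assms(2) unfolding exponents_def by blast
  then have "X \<in> toroidal_minus k"
    using assms(1) unfolding free_algebra_carrier by (auto simp: in_lists_conv_set)
  then show ?thesis using n unfolding toroidal_minus_iff by blast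
qed

lemma finite_exponents: "a \<in> carrier (free_algebra L) \<Longrightarrow> finite (exponents a)"
  unfolding exponents_def free_algebra_carrier by auto

text \<open>The polarisation formula is applied to the functional of \<open>exists_leading_functional\<close>, with the
monomials \<open>b \<otimes> t\<^sup>n\<close> as vectors, where \<open>b\<close> runs through a basis of \<open>\<gg>\<close> and \<open>n\<close> through the
exponents of \<open>a\<close>.\<close>

lemma exists_nonzero_slots:
  fixes B :: "'a \<Rightarrow> 'a \<Rightarrow> complex"
  defines "sc \<equiv> tor_scale scale" and "br \<equiv> tor_bracket scale bracket B"
  assumes Z: "Z \<in> carrier (uea sc br (toroidal_minus k))"
    and nonconst: "\<And>c. Z \<noteq> uea_scalar sc br (toroidal_minus k) c"
  obtains a ps where "a \<in> carrier (free_algebra (toroidal_minus k))"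
    and "Z = uea_ideal sc br (toroidal_minus k) +>\<^bsub>free_algebra (toroidal_minus k)\<^esub> a"
    and "ps \<noteq> []" and "\<And>w. a w \<noteq> 0 \<Longrightarrow> length w \<le> length ps"
    and "\<And>\<beta> n. (\<beta>, n) \<in> set ps \<Longrightarrow> Vector_Spaces.linear scale (*) \<beta> \<and> n \<in> exponents a"
    and "evaluate (convs (map (\<lambda>(\<beta>, n). slot n \<beta>) ps)) a \<noteq> 0"
proof -
  let ?L = "toroidal_minus k :: 'a tor set"
  interpret lie_subset sc br ?L
    unfolding sc_def br_def by (rule lie_subset_toroidal_minus) (rule lie_algebra_axioms)
  obtain a d M where a: "a \<in> carrier (free_algebra ?L)" "Z = I +>\<^bsub>free_algebra ?L\<^esub> a"
    and len: "\<forall>w. a w \<noteq> 0 \<longrightarrow> length w \<le> Suc d"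
    and M: "symmetric_functional sc ?L (Suc d) M" and Ma: "evaluate M a \<noteq> 0"
    using exists_leading_functional[OF Z nonconst] by blast
  have low: "M w = 0" if "w \<in> lists ?L" "length w \<le> d" for w
    using M that unfolding symmetric_functional_def by (simp add: less_Suc_eq_le)
  have add: "M (u @ (x + y) # v) = M (u @ x # v) + M (u @ y # v)"
    if "u \<in> lists ?L" "v \<in> lists ?L" "x \<in> ?L" "y \<in> ?L" for u v x y
    using M that unfolding symmetric_functional_def by blast
  have scale: "M (u @ sc c x # v) = c * M (u @ x # v)"
    if "u \<in> lists ?L" "v \<in> lists ?L" "x \<in> ?L" for u v c x
    using M that unfolding symmetric_functional_def by blast
  have swap: "M (u @ x # y # v) = M (u @ y # x # v)"
    if "u \<in> lists ?L" "v \<in> lists ?L" "x \<in> ?L" "y \<in> ?L" "length (u @ x # y # v) = Suc d" for u v x y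
    using M that unfolding symmetric_functional_def by blast
  obtain E \<beta> where E: "finite E" "\<And>b. b \<in> E \<Longrightarrow> Vector_Spaces.linear scale (*) (\<beta> b)"
    "\<And>v. (\<Sum>b\<in>E. scale (\<beta> b v) b) = v"
    using finite_coordinates by metis
  define A where "A = (\<Union>w\<in>{w. a w \<noteq> 0}. set w)"
  have finA: "finite A" and AL: "A \<subseteq> ?L"
    using a(1) unfolding A_def free_algebra_carrier by (auto simp: in_lists_conv_set)
  have supp: "w \<in> lists A" if "a w \<noteq> 0" for w using that by (auto simp: A_def)
  have finK: "finite (exponents a)" using finite_exponents[OF a(1)] .
  have KA: "Poly_Mapping.keys (fst X) \<subseteq> exponents a" if "X \<in> A" for X
    using that unfolding exponents_def A_def by blast
  define J where "J = E \<times> exponents a"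
  define e where "e = (\<lambda>(b, n). tor_monom b n :: 'a tor)"
  define \<psi> where "\<psi> = (\<lambda>(b, n) (X :: 'a tor). \<beta> b (Poly_Mapping.lookup (fst X) n))"
  have finJ: "finite J" using E(1) finK by (simp add: J_def)
  have eL: "e i \<in> ?L" if "i \<in> J" for i
  proof -
    obtain b n where i: "i = (b, n)" "n \<in> exponents a" using \<open>i \<in> J\<close> by (auto simp: J_def)
    then have "Poly_Mapping.keys n \<subseteq> {1..k} \<and> Poly_Mapping.lookup n k \<le> -1"
      using exponents_toroidal_minus[OF a(1)] by blast
    then show ?thesis
      using keys_single_subset[of n "{n. Poly_Mapping.keys n \<subseteq> {1..k} \<and> Poly_Mapping.lookup n k \<le> -1}" b]
      by (simp add: i e_def tor_monom_def toroidal_minus_iff zero_prod_def)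
  qed
  have decompose: "X = (\<Sum>i\<in>J. sc (\<psi> i X) (e i))" if "X \<in> A" for X
  proof (rule prod_eqI)
    have "snd X = 0" using that AL by (auto simp: toroidal_minus_iff)
    then show "snd X = snd (\<Sum>i\<in>J. sc (\<psi> i X) (e i))"
      by (simp add: snd_sum sc_def snd_tor_scale e_def tor_monom_def case_prod_unfold zero_prod_def[symmetric])
    show "fst X = fst (\<Sum>i\<in>J. sc (\<psi> i X) (e i))"
    proof (rule poly_mapping_eqI)
      fix m
      have map_single: "Poly_Mapping.map (scale c) (Poly_Mapping.single n b) = Poly_Mapping.single n (scale c b)" for c b and n :: expo
        by (rule poly_mapping_eqI) (simp add: map.rep_eq lookup_single when_def)
      have "Poly_Mapping.lookup (fst (\<Sum>i\<in>J. sc (\<psi> i X) (e i))) m =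
          (\<Sum>(b, n)\<in>J. if n = m then scale (\<beta> b (Poly_Mapping.lookup (fst X) n)) b else 0)"
        by (simp add: fst_sum lookup_sum sc_def fst_tor_scale e_def tor_monom_def case_prod_unfold
            map_single lookup_single when_def \<psi>_def)
      also have "\<dots> = (\<Sum>b\<in>E. \<Sum>n\<in>exponents a. if n = m then scale (\<beta> b (Poly_Mapping.lookup (fst X) n)) b else 0)"
        unfolding J_def by (rule sum.cartesian_product[symmetric])
      also have "\<dots> = (if m \<in> exponents a then Poly_Mapping.lookup (fst X) m else 0)"
        using finK E(3) by (simp add: sum.delta)
      also have "\<dots> = Poly_Mapping.lookup (fst X) m"
        using KA[OF \<open>X \<in> A\<close>] by (auto simp: in_keys_iff)
      finally show "Poly_Mapping.lookup (fst X) m = Poly_Mapping.lookup (fst (\<Sum>i\<in>J. sc (\<psi> i X) (e i))) m" ..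
    qed
  qed
  have zero: "0 \<in> ?L" by (simp add: toroidal_minus_iff)
  \<comment> \<open>Additivity only holds within the subalgebra, so the partial sums are tracked as members of it.\<close>
  have expand: "M (u @ X # v) = (\<Sum>i\<in>J. \<psi> i X * M (u @ e i # v))"
    if "X \<in> A" and uv: "u \<in> lists ?L" "v \<in> lists ?L" for u v X
  proof -
    have "(\<Sum>i\<in>S. sc (c i) (e i)) \<in> ?L \<and>
        M (u @ (\<Sum>i\<in>S. sc (c i) (e i)) # v) = (\<Sum>i\<in>S. c i * M (u @ e i # v))"
      if "finite S" "S \<subseteq> J" for S c
      using that
    proof induction
      case empty
      show ?case using zero add[OF uv zero zero] by simp
    next
      case (insert i S)
      then show ?case
        using eL[of i] add[OF uv] scale[OF uv] by (simp add: add_closed scale_closed)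
    qed
    from this[OF finJ subset_refl, of "\<lambda>i. \<psi> i X"] show ?thesis
      using decompose[OF \<open>X \<in> A\<close>] by simp
  qed
  define G where "G s = convs (map (\<lambda>i. letter_functional (\<psi> i)) s)" for s
  let ?S = "{s. set s \<subseteq> J \<and> length s = Suc d}"
  have step: "fact (Suc d) * M w = (\<Sum>s\<in>?S. G s w * M (map e s))" if w: "a w \<noteq> 0" for w
  proof (cases "length w = Suc d")
    case True
    have "fact (length w) * M ([] @ w) = (\<Sum>s\<in>{s. set s \<subseteq> J \<and> length s = length w}. G s w * M ([] @ map e s))"
      unfolding G_def
      by (rule symmetric_functional_expansion[OF finJ eL AL expand swap]) (use True supp[OF w] in auto)
    then show ?thesis by (simp only: True append_Nil)
  next
    case False
    then have short: "length w \<le> d" using len w by fastforce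
    moreover have "w \<in> lists ?L" using supp[OF w] AL by (meson lists_mono subsetD)
    ultimately have "M w = 0" by (rule low[rotated])
    moreover have "G s w = 0" if "s \<in> ?S" for s
      unfolding G_def by (rule convs_vanishes) (use that short in auto)
    ultimately show ?thesis by simp
  qed
  have "fact (Suc d) * evaluate M a = (\<Sum>w | a w \<noteq> 0. a w * (fact (Suc d) * M w))"
    by (simp add: evaluate_def sum_distrib_left mult.left_commute del: fact_Suc)
  also have "\<dots> = (\<Sum>w | a w \<noteq> 0. a w * (\<Sum>s\<in>?S. G s w * M (map e s)))"
    using step by (intro sum.cong refl arg_cong[where f = "(*) _"]) blast
  also have "\<dots> = (\<Sum>s\<in>?S. evaluate (G s) a * M (map e s))"
    unfolding evaluate_def sum_distrib_left sum_distrib_right by (subst sum.swap) (simp add: mult.assoc)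
  finally have "(\<Sum>s\<in>?S. evaluate (G s) a * M (map e s)) \<noteq> 0"
    using Ma by (metis fact_nonzero mult_eq_0_iff)
  then obtain s where s: "s \<in> ?S" "evaluate (G s) a \<noteq> 0"
    by (metis (no_types, lifting) mult_eq_0_iff sum.not_neutral_contains_not_neutral)
  have slots: "map (\<lambda>(\<beta>, n). slot n \<beta>) (map (\<lambda>(b, n). (\<beta> b, n)) s) = map (\<lambda>i. letter_functional (\<psi> i)) s"
    by (simp add: slot_def \<psi>_def case_prod_unfold)
  show ?thesis
  proof (rule that[OF a])
    show "map (\<lambda>(b, n). (\<beta> b, n)) s \<noteq> []" using s(1) by auto
    show "length w \<le> length (map (\<lambda>(b, n). (\<beta> b, n)) s)" if "a w \<noteq> 0" for w
      using s(1) len that by simp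
    show "Vector_Spaces.linear scale (*) \<beta>' \<and> n \<in> exponents a"
      if "(\<beta>', n) \<in> set (map (\<lambda>(b, n). (\<beta> b, n)) s)" for \<beta>' n
      using that s(1) E(2) by (auto simp: J_def)
    show "evaluate (convs (map (\<lambda>(\<beta>, n). slot n \<beta>) (map (\<lambda>(b, n). (\<beta> b, n)) s))) a \<noteq> 0"
      using s(2) unfolding slots G_def .
  qed
qed

lemma linear_functional_double_bracket:
  assumes "Vector_Spaces.linear scale (*) \<eta>"
  shows "Vector_Spaces.linear scale (*) (\<lambda>y. \<eta> (bracket (bracket x y) z))"
  using Vector_Spaces.linear_compose[OF bracket_linear_right linear_functional_bracket_right[OF assms]]
  by (simp add: o_def)

text \<open>The first factor is a matrix coefficient at \<open>n1 + e\<close>, which the commutator moves back to \<open>n1\<close>.  The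
commutator makes each of the other factors read an exponent \<open>n - e\<close> that no letter of \<open>a\<close>
has, so those terms vanish and one product remains.\<close>

lemma ad_convs_matrix_coefficients:
  assumes a: "a \<in> carrier (free_algebra (toroidal_minus k))"
    and ts: "\<And>\<eta> z n. (\<eta>, z, n) \<in> set ts \<Longrightarrow> Vector_Spaces.linear scale (*) \<eta> \<and> n \<in> exponents a"
    and \<eta>1: "Vector_Spaces.linear scale (*) \<eta>1" and n1: "n1 \<in> exponents a"
    and len: "\<And>w. a w \<noteq> 0 \<Longrightarrow> length w \<le> Suc (length ts)"
    and e: "Poly_Mapping.lookup e k = 0"
    and shift: "\<And>n. n \<in> exponents a \<Longrightarrow> n - e \<notin> exponents a"
  shows "evaluate (ad_functional (tor_monom x e)
      (convs (matrix_coefficient \<eta>1 (n1 + e) z1 # map (\<lambda>(\<eta>, z, n). matrix_coefficient \<eta> n z) ts))) a =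
    evaluate (convs (slot n1 (\<lambda>y. \<eta>1 (bracket (bracket x y) z1)) #
      map (\<lambda>(\<eta>, z, n). slot n (\<lambda>y. \<eta> (bracket y z))) ts)) a"
proof (rule evaluate_cong)
  fix w assume w: "a w \<noteq> 0"
  let ?fs = "map (\<lambda>(\<eta>, z, n). matrix_coefficient \<eta> n z) ts"
  let ?A = "{X \<in> toroidal_minus k :: 'a tor set. Poly_Mapping.keys (fst X) \<subseteq> exponents a}"
  have nonzero: "n \<noteq> 0 \<and> n + e \<noteq> 0" if "n \<in> exponents a" for n
  proof -
    have "Poly_Mapping.lookup n k \<le> -1" "Poly_Mapping.lookup (n + e) k \<le> -1"
      using exponents_toroidal_minus[OF a that] e by (simp_all add: lookup_add)
    then show ?thesis by auto
  qed
  have "w \<in> lists (toroidal_minus k)" using a w unfolding free_algebra_carrier by blast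
  then have wA: "w \<in> lists ?A" using w unfolding exponents_def by (auto simp: in_lists_conv_set)
  have "ad_functional (tor_monom x e) (convs (matrix_coefficient \<eta>1 (n1 + e) z1 # ?fs)) w =
    convs (letter_functional (\<lambda>X. \<eta>1 (bracket (bracket x (Poly_Mapping.lookup (fst X) n1)) z1)) #
      map (\<lambda>f. letter_functional (\<lambda>X. f [X])) ?fs) w"
  proof (rule ad_functional_convs_leading)
    show "matrix_coefficient \<eta>1 (n1 + e) z1 [] = 0"
      using nonzero[OF n1] by (intro matrix_coefficient_Nil \<eta>1) blast
    fix X assume X: "X \<in> ?A"
    then have X0: "snd (snd X) = 0" by (simp add: toroidal_minus_iff)
    then show "ad_functional (tor_monom x e) (matrix_coefficient \<eta>1 (n1 + e) z1) [X] =
        \<eta>1 (bracket (bracket x (Poly_Mapping.lookup (fst X) n1)) z1)"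
      using ad_matrix_coefficient_letter[OF \<eta>1, of "n1 + e"] nonzero[OF n1] by simp
    fix f assume "f \<in> set ?fs"
    then obtain \<eta> z n where f: "f = matrix_coefficient \<eta> n z" and t: "(\<eta>, z, n) \<in> set ts" by auto
    have \<eta>: "Vector_Spaces.linear scale (*) \<eta>" and n: "n \<in> exponents a" using ts[OF t] by auto
    interpret \<eta>: Vector_Spaces.linear scale "(*)" \<eta> by (rule \<eta>)
    have "Poly_Mapping.lookup (fst X) (n - e) = 0"
      using X shift[OF n] by (auto simp: in_keys_iff)
    then show "ad_functional (tor_monom x e) f [X] = 0"
      unfolding f using ad_matrix_coefficient_letter[OF \<eta> _ X0, of n] nonzero[OF n]
      by (simp add: \<eta>.zero)
  next
    fix f assume "f \<in> set ?fs"
    then obtain \<eta> z n where f: "f = matrix_coefficient \<eta> n z" and t: "(\<eta>, z, n) \<in> set ts" by auto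
    show "f [] = 0" unfolding f using ts[OF t] nonzero by (intro matrix_coefficient_Nil) auto
  qed (use wA len[OF w] in auto)
  also have "map (\<lambda>f. letter_functional (\<lambda>X. f [X])) ?fs =
      map (\<lambda>(\<eta>, z, n). slot n (\<lambda>y. \<eta> (bracket y z))) ts"
    using ts nonzero by (auto simp: slot_def matrix_coefficient_letter)
  finally show "ad_functional (tor_monom x e) (convs (matrix_coefficient \<eta>1 (n1 + e) z1 # ?fs)) w =
    convs (slot n1 (\<lambda>y. \<eta>1 (bracket (bracket x y) z1)) #
      map (\<lambda>(\<eta>, z, n). slot n (\<lambda>y. \<eta> (bracket y z))) ts) w"
    by (simp only: slot_def)
qed

text \<open>Any \<open>p\<close> beyond all differences of the \<open>i\<close>-th entries of two exponents in \<open>K\<close> works.\<close>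

lemma exists_large_shift:
  fixes K :: "expo set"
  assumes "finite K"
  shows "\<exists>p::int. p > 0 \<and> (\<forall>r\<ge>p. \<forall>n\<in>K. n - Poly_Mapping.single i r \<notin> K)"
proof -
  define D where "D = (\<lambda>(n, m). Poly_Mapping.lookup n i - Poly_Mapping.lookup m i) ` (K \<times> K)"
  have fin: "finite (insert 0 D)" using assms by (simp add: D_def)
  define p where "p = Max (insert 0 D) + 1"
  have le: "d < p" if "d \<in> insert 0 D" for d
    using Max_ge[OF fin that] by (simp add: p_def)
  have "n - Poly_Mapping.single i r \<notin> K" if "r \<ge> p" "n \<in> K" for n r
  proof
    assume "n - Poly_Mapping.single i r \<in> K"
    then have "Poly_Mapping.lookup n i - Poly_Mapping.lookup (n - Poly_Mapping.single i r) i \<in> D"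
      using \<open>n \<in> K\<close> unfolding D_def by (intro image_eqI[of _ _ "(n, n - Poly_Mapping.single i r)"]) auto
    then have "r \<in> D" by (simp add: lookup_minus)
    then show False using le[of r] that(1) by simp
  qed
  then show ?thesis using le[of 0] by blast
qed

text \<open>The element \<open>x\<close> is found before \<open>r\<close>: it is chosen for the vector \<open>y\<close> that represents the first slot,
and the same \<open>x\<close> serves for all \<open>r \<ge> p\<close>.\<close>

lemma commutator_with_large_shift_nonzero:
  fixes B :: "'a \<Rightarrow> 'a \<Rightarrow> complex" and k :: nat
  defines "sc \<equiv> tor_scale scale" and "br \<equiv> tor_bracket scale bracket B"
  assumes k: "k \<ge> 2"
    and Z: "Z \<in> carrier (uea sc br (toroidal_minus k))"
    and nonconst: "\<And>c. Z \<noteq> uea_scalar sc br (toroidal_minus k) c"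
  shows "\<exists>p::int. p > 0 \<and> (\<forall>r\<ge>p. \<exists>x. commutator (uea sc br (toroidal k))
       (uea_of sc br (toroidal k) (tor_monom x (Poly_Mapping.single (k - 1) r)))
       (uea_extend sc br (toroidal k) Z) \<noteq> \<zero>\<^bsub>uea sc br (toroidal k)\<^esub>)"
proof -
  let ?M = "toroidal_minus k :: 'a tor set" and ?L = "toroidal k :: 'a tor set"
  interpret M: lie_subset sc br ?M
    unfolding sc_def br_def by (rule lie_subset_toroidal_minus) (rule lie_algebra_axioms)
  interpret L: lie_subset sc br ?L
    unfolding sc_def br_def by (rule lie_subset_toroidal)
  obtain a ps where a: "a \<in> carrier (free_algebra ?M)" "Z = M.I +>\<^bsub>free_algebra ?M\<^esub> a"
    and ps: "ps \<noteq> []" "\<And>w. a w \<noteq> 0 \<Longrightarrow> length w \<le> length ps"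
      "\<And>\<beta> n. (\<beta>, n) \<in> set ps \<Longrightarrow> Vector_Spaces.linear scale (*) \<beta> \<and> n \<in> exponents a"
      "evaluate (convs (map (\<lambda>(\<beta>, n). slot n \<beta>) ps)) a \<noteq> 0"
    using exists_nonzero_slots[OF Z[unfolded sc_def br_def] nonconst[unfolded sc_def br_def]]
    unfolding sc_def br_def by metis
  obtain \<beta>1 n1 ps' where ps': "ps = (\<beta>1, n1) # ps'" using ps(1) by (cases ps) auto
  have \<beta>1: "Vector_Spaces.linear scale (*) \<beta>1" and n1: "n1 \<in> exponents a"
    using ps(3)[of \<beta>1 n1] ps' by auto
  obtain ts where ts: "map (\<lambda>(\<eta>, z, n). n) ts = map snd ps'"
    "\<forall>t\<in>set ts. Vector_Spaces.linear scale (*) (fst t)"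
    "evaluate (convs ([slot n1 \<beta>1] @ map (\<lambda>(\<eta>, z, n). slot n (\<lambda>y. \<eta> (bracket y z))) ts)) a \<noteq> 0"
    using slots_realizable[of ps' "[slot n1 \<beta>1]" a] ps(3,4) ps' by auto
  let ?rest = "map (\<lambda>(\<eta>, z, n). slot n (\<lambda>y. \<eta> (bracket y z))) ts"
  obtain y where y: "\<And>\<beta>. Vector_Spaces.linear scale (*) \<beta> \<Longrightarrow>
      evaluate (convs (slot n1 \<beta> # ?rest)) a = \<beta> y"
    using slot_represented[of "[]" n1 ?rest a] by auto
  interpret \<beta>1: Vector_Spaces.linear scale "(*)" \<beta>1 by (rule \<beta>1)
  have "y \<noteq> 0" using ts(3) y[OF \<beta>1] \<beta>1.zero by auto
  then obtain x where "bracket x y \<noteq> 0" using center_trivial by blast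
  then obtain \<eta>1 z1 where \<eta>1: "Vector_Spaces.linear scale (*) \<eta>1" "\<eta>1 (bracket (bracket x y) z1) \<noteq> 0"
    using exists_bracket_functional by blast
  have nonzero: "evaluate (convs (slot n1 (\<lambda>y. \<eta>1 (bracket (bracket x y) z1)) # ?rest)) a \<noteq> 0"
    using y[OF linear_functional_double_bracket[OF \<eta>1(1)]] \<eta>1(2) by simp
  have ts_set: "Vector_Spaces.linear scale (*) \<eta> \<and> n \<in> exponents a" if t: "(\<eta>, z, n) \<in> set ts" for \<eta> z n
  proof -
    have "n \<in> set (map (\<lambda>(\<eta>, z, n). n) ts)" using t by force
    then have "\<exists>\<beta>. (\<beta>, n) \<in> set ps" unfolding ts(1) using ps' by force
    then obtain \<beta> where "(\<beta>, n) \<in> set ps" by blast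
    then show ?thesis using ps(3) ts(2) t by force
  qed
  have "length ts = length ps'" using arg_cong[OF ts(1), of length] by simp
  then have len: "length w \<le> Suc (length ts)" if "a w \<noteq> 0" for w
    using ps(2)[OF that] ps' by simp
  obtain p :: int where p: "p > 0"
    "\<And>r n. \<lbrakk>r \<ge> p; n \<in> exponents a\<rbrakk> \<Longrightarrow> n - Poly_Mapping.single (k - 1) r \<notin> exponents a"
    using exists_large_shift[OF finite_exponents[OF a(1)], of "k - 1"] by blast
  have sub: "M.I \<subseteq> L.I"
    by (rule uea_ideal_mono) (simp_all add: M.lie_subset_axioms L.lie_subset_axioms toroidal_minus_subset)
  have aL: "a \<in> carrier (free_algebra ?L)"
    using a(1) lists_mono[OF toroidal_minus_subset] unfolding free_algebra_carrier by blast
  have "commutator (uea sc br ?L) (uea_of sc br ?L (tor_monom x (Poly_Mapping.single (k - 1) r)))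
      (uea_extend sc br ?L Z) \<noteq> \<zero>\<^bsub>uea sc br ?L\<^esub>" if "r \<ge> p" for r
  proof
    let ?e = "Poly_Mapping.single (k - 1) r"
    let ?X = "tor_monom x ?e"
    let ?F = "convs (matrix_coefficient \<eta>1 (n1 + ?e) z1 # map (\<lambda>(\<eta>, z, n). matrix_coefficient \<eta> n z) ts)"
    have X: "?X \<in> ?L"
      using k by (auto simp: toroidal_iff tor_monom_def)
    have "uea_extend sc br ?L Z = L.I <+>\<^bsub>free_algebra ?L\<^esub> (M.I +>\<^bsub>free_algebra ?L\<^esub> a)"
      by (simp add: uea_extend_def a(2) a_r_coset_def')
    also have "\<dots> = L.I +>\<^bsub>free_algebra ?L\<^esub> a"
      using ideal.axioms(1)[OF M.ideal_uea, THEN additive_subgroup.zero_closed]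
      by (intro set_add_rcos_ideal L.ideal_uea sub aL) simp
    finally have ext: "uea_extend sc br ?L Z = L.I +>\<^bsub>free_algebra ?L\<^esub> a" .
    assume "commutator (uea sc br ?L) (uea_of sc br ?L ?X) (uea_extend sc br ?L Z) = \<zero>\<^bsub>uea sc br ?L\<^esub>"
    then have "commutator (free_algebra ?L) (free_letter ?X) a \<in> L.I"
      unfolding ext uea_def uea_of_def
      using X by (intro ideal.commutator_quotient_eq_zeroD[OF L.ideal_uea] aL)
        (simp_all add: free_letter_eq_word word_closed)
    moreover have "enveloping_functional sc br ?F"
      unfolding sc_def br_def
      by (rule enveloping_functional_convs)
        (use ts_set \<eta>1(1) in \<open>auto intro: enveloping_functional_matrix_coefficient\<close>)
    ultimately have "evaluate (ad_functional ?X ?F) a = 0"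
      using L.uea_ideal_annihilated evaluate_commutator_letter[OF X aL] by metis
    moreover have "evaluate (ad_functional ?X ?F) a =
        evaluate (convs (slot n1 (\<lambda>y. \<eta>1 (bracket (bracket x y) z1)) # ?rest)) a"
      by (rule ad_convs_matrix_coefficients[OF a(1) ts_set \<eta>1(1) n1 len])
        (use k p(2)[OF that] in \<open>auto simp: lookup_single\<close>)
    ultimately show False using nonzero by simp
  qed
  then show ?thesis using p(1) by blast
qed

end

theorem theorem1:
  fixes scale :: "complex \<Rightarrow> 'g::ab_group_add \<Rightarrow> 'g"
    and bracket :: "'g \<Rightarrow> 'g \<Rightarrow> 'g"
    and B :: "'g \<Rightarrow> 'g \<Rightarrow> complex"
    and H :: "'g set"
    and \<Delta> :: "('g \<Rightarrow> complex) set"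
    and \<theta> :: "'g \<Rightarrow> complex"
    and k :: nat
    and Z :: "('g tor list \<Rightarrow> complex) set"
  assumes "simple_lie_algebra scale bracket"
    and "lie_algebra.cartan_subalgebra scale bracket H"
    and "lie_algebra.simple_roots scale bracket H \<Delta>"
    and "lie_algebra.highest_root scale bracket H \<Delta> \<theta>"
    and "lie_algebra.invariant_form scale bracket B"
    and "induced_form B H \<theta> \<theta> = 2"
    and "k \<ge> 2"
    and "Z \<in> carrier (uea (tor_scale scale) (tor_bracket scale bracket B) (toroidal_minus k))"
    and "\<forall>c. Z \<noteq> uea_scalar (tor_scale scale) (tor_bracket scale bracket B) (toroidal_minus k) c"
  shows "\<exists>p::int. p > 0 \<and> (\<forall>r\<ge>p. \<exists>x.
     commutator (uea (tor_scale scale) (tor_bracket scale bracket B) (toroidal k))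
       (uea_of (tor_scale scale) (tor_bracket scale bracket B) (toroidal k)
         (tor_monom x (Poly_Mapping.single (k - 1) r)))
       (uea_extend (tor_scale scale) (tor_bracket scale bracket B) (toroidal k) Z)
     \<noteq> \<zero>\<^bsub>uea (tor_scale scale) (tor_bracket scale bracket B) (toroidal k)\<^esub>)"
proof -
  interpret simple_lie_algebra scale bracket by fact
  show ?thesis
    by (rule commutator_with_large_shift_nonzero) (use assms(7-9) in auto)
qed

end
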